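(* The subspace $\mathbb{T}_2$ of binary algebraic measure trees with atoms restricted to leaves is closed in $\mathbb{T}$ with respect to the bpdd-Gromov-weak topology.
   Context: **Algebraic trees.** An algebraic tree $(T,c)$ is a set $T\neq\emptyset$ with a map $c\colon T^3\to T$ such that for all points: $c$ is symmetric; $c(x,y,y)=y$; $c(x,y,c(x,y,z))=c(x,y,z)$; $c(x_1,x_2,x_3)\in\{c(x_1,x_2,x_4),c(x_1,x_3,x_4),c(x_2,x_3,x_4)\}$. Intervals: $[x,y]:=\{z: c(x,y,z)=z\}$, $[x,y):=[x,y]\setminus\{y\}$. For $x\ne y$ the component is $\mathcal{S}_x(y):=\{z\in T\setminus\{x\}: c(x,y,z)\neq x\}$. The component topology on $T$ is generated by the sets $\mathcal{S}_x(y)$, $x\neq y$; $\mathcal{B}(T,c)$ is its Borel $\sigma$-algebra. $\deg(v)$ is the number of distinct sets $\mathcal{S}_v(y)$, $y\ne v$; $(T,c)$ is binary if $\deg\le3$ everywhere. $\mathrm{lf}(T,c):=\{u: c(u,v,w)\ne u\ \forall v,w\in T\setminus\{u\}\}$. $(T,c)$ is order separable if there is a countable $D\subseteq T$ with $D\cap[x,y)\ne\emptyset$ for all $x\ne y$. A subtree is a non-empty $A\subseteq T$ with $c(A^3)\subseteq A$; a tree isomorphism is a bijection commuting with the branch point maps. **Algebraic measure trees.** An algebraic measure tree $(T,c,\mu)$ is an order separable algebraic tree with a probability measure $\mu$ on $\mathcal{B}(T,c)$. Two of them, $(T_i,c_i,\mu_i)$, are equivalent if there are subtrees $A_i\subseteq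 T_i$ with $\mu_i(A_i)=1$ and a measure preserving tree isomorphism $A_1\to A_2$. $\mathbb{T}$ is the set of equivalence classes of algebraic measure trees. $\mathbb{T}_2\subseteq\mathbb{T}$ is the set of (classes of) $(T,c,\mu)$ with $(T,c)$ binary and all atoms of $\mu$ contained in $\mathrm{lf}(T,c)$. **bpdd-Gromov-weak topology.** For $(T,c,\mu)$ let $\nu:=c_*\mu^{\otimes3}$ and $r_\nu(x,y):=\nu([x,y])-\frac12\nu\{x\}-\frac12\nu\{y\}$. The bpdd-Gromov-weak topology on $\mathbb{T}$ is the coarsest topology for which all maps $(T,c,\mu)\mapsto\int_{T^m}\phi\big((r_\nu(x_i,x_j))_{1\le i,j\le m}\big)\,\mu^{\otimes m}(d\underline{x})$, $m\in\mathbb{N}$, $\phi\in\mathcal{C}_b(\mathbb{R}^{m\times m})$, are continuous. *)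

theory Defs
  imports "HOL-Probability.Probability" "HOL-Library.Extended_Nat"
begin

section \<open>Algebraic trees\<close>

text \<open>Trees have an explicit carrier \<open>T\<close>; values of \<open>c\<close> outside of \<open>T\<close> are irrelevant.\<close>

locale algebraic_tree =
  fixes T :: "'a set" and c :: "'a \<Rightarrow> 'a \<Rightarrow> 'a \<Rightarrow> 'a"
  assumes nonempty: "T \<noteq> {}"
    and closed: "\<lbrakk>x \<in> T; y \<in> T; z \<in> T\<rbrakk> \<Longrightarrow> c x y z \<in> T"
    and sym12: "\<lbrakk>x \<in> T; y \<in> T; z \<in> T\<rbrakk> \<Longrightarrow> c x y z = c y x z"
    and sym23: "\<lbrakk>x \<in> T; y \<in> T; z \<in> T\<rbrakk> \<Longrightarrow> c x y z = c x z y"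
    and two_point: "\<lbrakk>x \<in> T; y \<in> T\<rbrakk> \<Longrightarrow> c x y y = y"
    and three_point: "\<lbrakk>x \<in> T; y \<in> T; z \<in> T\<rbrakk> \<Longrightarrow> c x y (c x y z) = c x y z"
    and four_point: "\<lbrakk>x1 \<in> T; x2 \<in> T; x3 \<in> T; x4 \<in> T\<rbrakk>
           \<Longrightarrow> c x1 x2 x3 \<in> {c x1 x2 x4, c x1 x3 x4, c x2 x3 x4}"

definition tree_interval :: "'a set \<Rightarrow> ('a \<Rightarrow> 'a \<Rightarrow> 'a \<Rightarrow> 'a) \<Rightarrow> 'a \<Rightarrow> 'a \<Rightarrow> 'a set" where
  "tree_interval T c x y = {z \<in> T. c x y z = z}"

definition tree_component :: "'a set \<Rightarrow> ('a \<Rightarrow> 'a \<Rightarrow> 'a \<Rightarrow> 'a) \<Rightarrow> 'a \<Rightarrow> 'a \<Rightarrow> 'a set" where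
  "tree_component T c x y = {z \<in> T - {x}. c x y z \<noteq> x}"

text \<open>The whole space is added to the generators only for the sake of the one-point tree, which
  has no pairs \<open>x \<noteq> y\<close>; otherwise the components cover \<open>T\<close>.\<close>

definition component_topology :: "'a set \<Rightarrow> ('a \<Rightarrow> 'a \<Rightarrow> 'a \<Rightarrow> 'a) \<Rightarrow> 'a topology" where
  "component_topology T c =
     topology_generated_by (insert T {tree_component T c x y |x y. x \<in> T \<and> y \<in> T \<and> x \<noteq> y})"

definition tree_borel :: "'a set \<Rightarrow> ('a \<Rightarrow> 'a \<Rightarrow> 'a \<Rightarrow> 'a) \<Rightarrow> 'a measure" where
  "tree_borel T c = sigma T {U. openin (component_topology T c) U}"

definition tree_degree :: "'a set \<Rightarrow> ('a \<Rightarrow> 'a \<Rightarrow> 'a \<Rightarrow> 'a) \<Rightarrow> 'a \<Rightarrow> enat" where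
  "tree_degree T c v =
     (let \<C> = tree_component T c v ` (T - {v}) in if finite \<C> then enat (card \<C>) else \<infinity>)"

definition binary_tree :: "'a set \<Rightarrow> ('a \<Rightarrow> 'a \<Rightarrow> 'a \<Rightarrow> 'a) \<Rightarrow> bool" where
  "binary_tree T c \<longleftrightarrow> (\<forall>v\<in>T. tree_degree T c v \<le> 3)"

definition leaves :: "'a set \<Rightarrow> ('a \<Rightarrow> 'a \<Rightarrow> 'a \<Rightarrow> 'a) \<Rightarrow> 'a set" where
  "leaves T c = {u \<in> T. \<forall>v\<in>T - {u}. \<forall>w\<in>T - {u}. c u v w \<noteq> u}"

definition order_separable :: "'a set \<Rightarrow> ('a \<Rightarrow> 'a \<Rightarrow> 'a \<Rightarrow> 'a) \<Rightarrow> bool" where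
  "order_separable T c \<longleftrightarrow>
     (\<exists>D\<subseteq>T. countable D \<and>
        (\<forall>x\<in>T. \<forall>y\<in>T. x \<noteq> y \<longrightarrow> D \<inter> (tree_interval T c x y - {y}) \<noteq> {}))"

definition subtree :: "'a set \<Rightarrow> 'a set \<Rightarrow> ('a \<Rightarrow> 'a \<Rightarrow> 'a \<Rightarrow> 'a) \<Rightarrow> bool" where
  "subtree A T c \<longleftrightarrow>
     A \<noteq> {} \<and> A \<subseteq> T \<and> (\<forall>x\<in>A. \<forall>y\<in>A. \<forall>z\<in>A. c x y z \<in> A)"

definition tree_iso ::
  "'a set \<Rightarrow> ('a \<Rightarrow> 'a \<Rightarrow> 'a \<Rightarrow> 'a) \<Rightarrow> 'b set \<Rightarrow> ('b \<Rightarrow> 'b \<Rightarrow> 'b \<Rightarrow> 'b) \<Rightarrow> ('a \<Rightarrow> 'b) \<Rightarrow> bool" where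
  "tree_iso A c B d f \<longleftrightarrow>
     bij_betw f A B \<and> (\<forall>x\<in>A. \<forall>y\<in>A. \<forall>z\<in>A. f (c x y z) = d (f x) (f y) (f z))"


section \<open>Algebraic measure trees\<close>

type_synonym 'a tree_triple = "'a set \<times> ('a \<Rightarrow> 'a \<Rightarrow> 'a \<Rightarrow> 'a) \<times> 'a measure"

definition algebraic_measure_trees :: "'a tree_triple set" where
  "algebraic_measure_trees =
     {(T, c, M). algebraic_tree T c \<and> order_separable T c \<and>
        space M = T \<and> sets M = sets (tree_borel T c) \<and> prob_space M}"

text \<open>The subtrees carry the trace \<open>\<sigma>\<close>-algebras and the restricted measures.\<close>

definition amt_equivalent :: "'a tree_triple \<Rightarrow> 'a tree_triple \<Rightarrow> bool" where
  "amt_equivalent = (\<lambda>(T1, c1, M1) (T2, c2, M2).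
     \<exists>A1 A2 f. subtree A1 T1 c1 \<and> A1 \<in> sets M1 \<and> measure M1 A1 = 1 \<and>
       subtree A2 T2 c2 \<and> A2 \<in> sets M2 \<and> measure M2 A2 = 1 \<and>
       tree_iso A1 c1 A2 c2 f \<and>
       f \<in> restrict_space M1 A1 \<rightarrow>\<^sub>M restrict_space M2 A2 \<and>
       distr (restrict_space M1 A1) (restrict_space M2 A2) f = restrict_space M2 A2)"

definition amt_rel :: "('a tree_triple \<times> 'a tree_triple) set" where
  "amt_rel = {(t1, t2). t1 \<in> algebraic_measure_trees \<and> t2 \<in> algebraic_measure_trees \<and>
                         amt_equivalent t1 t2}"

text \<open>The space of all algebraic measure trees with carrier in the (arbitrary) type \<open>'a\<close>. By the
  lemma \<open>order_separable_inj_nat_set\<close> below, no equivalence class is lost if \<open>'a\<close> has at least the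
  cardinality of the continuum, e.g. for \<open>'a = real\<close> or \<open>'a = nat set\<close>.\<close>

definition amt_space :: "'a tree_triple set set" where
  "amt_space = algebraic_measure_trees // amt_rel"

definition amt_space2 :: "'a tree_triple set set" where
  "amt_space2 = {X \<in> amt_space. \<exists>(T, c, M)\<in>X.
     binary_tree T c \<and> {x \<in> T. measure M {x} > 0} \<subseteq> leaves T c}"


section \<open>The bpdd-Gromov-weak topology\<close>

definition branch_point_distribution :: "('a \<Rightarrow> 'a \<Rightarrow> 'a \<Rightarrow> 'a) \<Rightarrow> 'a measure \<Rightarrow> 'a measure" where
  "branch_point_distribution c M =
     distr (M \<Otimes>\<^sub>M (M \<Otimes>\<^sub>M M)) M (\<lambda>(x, y, z). c x y z)"

definition bpd_dist :: "'a tree_triple \<Rightarrow> 'a \<Rightarrow> 'a \<Rightarrow> real" where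
  "bpd_dist = (\<lambda>(T, c, M) x y. let \<nu> = branch_point_distribution c M in
     measure \<nu> (tree_interval T c x y) - 1/2 * measure \<nu> {x} - 1/2 * measure \<nu> {y})"

text \<open>\<open>m \<times> m\<close> matrices are functions on \<open>{..<m} \<times> {..<m}\<close>, extended by
  \<open>undefined\<close> as in \<^const>\<open>product_topology\<close> and \<^const>\<open>PiM\<close>.\<close>

definition matrix_topology :: "nat \<Rightarrow> (nat \<times> nat \<Rightarrow> real) topology" where
  "matrix_topology m = product_topology (\<lambda>_. euclideanreal) ({..<m} \<times> {..<m})"

definition bounded_continuous :: "nat \<Rightarrow> ((nat \<times> nat \<Rightarrow> real) \<Rightarrow> real) set" where
  "bounded_continuous m = {\<phi>. continuous_map (matrix_topology m) euclideanreal \<phi> \<and>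
                               bounded (\<phi> ` topspace (matrix_topology m))}"

definition amt_polynomial ::
  "nat \<Rightarrow> ((nat \<times> nat \<Rightarrow> real) \<Rightarrow> real) \<Rightarrow> 'a tree_triple \<Rightarrow> real" where
  "amt_polynomial m \<phi> = (\<lambda>(T, c, M).
     \<integral>x. \<phi> (\<lambda>(i, j)\<in>{..<m} \<times> {..<m}. bpd_dist (T, c, M) (x i) (x j)) \<partial>(\<Pi>\<^sub>M i\<in>{..<m}. M))"

text \<open>\<^const>\<open>amt_polynomial\<close> is constant on equivalence classes; the map which it induces
  on classes is \<open>X \<mapsto> the_elem (amt_polynomial m \<phi> ` X)\<close>.\<close>

definition bpdd_Gromov_weak :: "'a tree_triple set topology" where
  "bpdd_Gromov_weak = topology_generated_by
     {{X \<in> amt_space. the_elem (amt_polynomial m \<phi> ` X) \<in> U} |m \<phi> U.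
        \<phi> \<in> bounded_continuous m \<and> open U}"

lemma topspace_bpdd_Gromov_weak: "topspace bpdd_Gromov_weak = amt_space"
proof -
  define \<B> :: "'a tree_triple set set set" where
    "\<B> = {{X \<in> amt_space. the_elem (amt_polynomial m \<phi> ` X) \<in> U} |m \<phi> U.
        \<phi> \<in> bounded_continuous m \<and> open U}"
  have "(\<lambda>_. 0) \<in> bounded_continuous 0"
    by (simp add: bounded_continuous_def image_constant_conv)
  then have "\<exists>m \<phi> U. amt_space = {X \<in> amt_space. the_elem (amt_polynomial m \<phi> ` X) \<in> U} \<and>
      \<phi> \<in> bounded_continuous m \<and> open U"
    by (intro exI[of _ 0] exI[of _ "\<lambda>_. 0"] exI[of _ UNIV]) simp
  then have "amt_space \<in> \<B>"
    unfolding \<B>_def by (rule CollectI)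
  moreover have "S \<subseteq> amt_space" if S: "S \<in> \<B>" for S
  proof -
    obtain m \<phi> U where "S = {X \<in> amt_space. the_elem (amt_polynomial m \<phi> ` X) \<in> U}"
      using S unfolding \<B>_def by (elim CollectE exE conjE)
    then show ?thesis by simp
  qed
  ultimately have "\<Union>\<B> = amt_space"
    by (intro subset_antisym Union_least Union_upper)
  then show ?thesis
    unfolding bpdd_Gromov_weak_def topology_generated_by_topspace \<B>_def .
qed

lemma (in algebraic_tree) order_separable_inj_nat_set:
  assumes "order_separable T c"
  shows "\<exists>f :: 'a \<Rightarrow> nat set. inj_on f T"
proof -
  obtain D where D: "D \<subseteq> T" "countable D"
    and dense: "\<forall>x\<in>T. \<forall>y\<in>T. x \<noteq> y \<longrightarrow> D \<inter> (tree_interval T c x y - {y}) \<noteq> {}"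
    using assms unfolding order_separable_def by (elim exE conjE)
  obtain r where r: "r \<in> T" using nonempty by blast
  define f where "f x = to_nat_on D ` (D \<inter> tree_interval T c r x)" for x
  have sep: "f x \<noteq> f y" if xy: "x \<in> T" "y \<in> T" and ne: "c r x y \<noteq> x" for x y
  proof -
    define m where "m = c r x y"
    have m: "m \<in> T" unfolding m_def by (rule closed[OF r xy])
    have "D \<inter> (tree_interval T c x m - {m}) \<noteq> {}"
      using dense xy(1) m ne by (simp add: m_def)
    then obtain d where d: "d \<in> D" "d \<in> T" "c x m d = d" "d \<noteq> m"
      unfolding tree_interval_def by blast
    have perm: "c u v w = c u w v" "c u v w = c v u w" if "u \<in> T" "v \<in> T" "w \<in> T" for u v w
      by (rule sym23[OF that], rule sym12[OF that])
    have mx: "c r x m = m"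
      unfolding m_def by (rule three_point[OF r xy])
    have 1: "c r x d = d"
    proof -
      have "c x m d \<in> {c x m r, c x d r, c m d r}"
        by (rule four_point[OF xy(1) m d(2) r])
      moreover have "c x m r = m"
        using mx perm(2)[OF r xy(1) m] perm(1)[OF xy(1) r m] by simp
      ultimately consider "c x d r = d" | "c m d r = d" using d by auto
      then show ?thesis
      proof cases
        case 1
        then show ?thesis unfolding perm(2)[OF r xy(1) d(2)] perm(1)[OF xy(1) r d(2)] .
      next
        case 2
        have "c r x d \<in> {c r x m, c r d m, c x d m}"
          by (rule four_point[OF r xy(1) d(2) m])
        moreover have "c r d m = d"
          unfolding perm(2)[OF r d(2) m] perm(1)[OF d(2) r m] perm(2)[OF d(2) m r] by (rule 2)
        moreover have xdm: "c x d m = d"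
          unfolding perm(1)[OF xy(1) d(2) m] by (rule d(3))
        moreover have "c r x d \<noteq> m"
        proof
          assume "c r x d = m"
          then have "c x d r = m"
            unfolding perm(2)[OF r xy(1) d(2)] perm(1)[OF xy(1) r d(2)] .
          with three_point[OF xy(1) d(2) r] have "c x d m = m" by simp
          with xdm d(4) show False by simp
        qed
        ultimately show ?thesis using mx by auto
      qed
    qed
    have 2: "c r y d \<noteq> d"
    proof
      assume eq: "c r y d = d"
      have "m \<in> {c r x d, c r y d, c x y d}"
        unfolding m_def by (rule four_point[OF r xy d(2)])
      then have xyd: "c x y d = m" using 1 eq d by auto
      then have "c x d y = m" unfolding perm(1)[OF xy d(2)] .
      with three_point[OF xy(1) d(2) xy(2)] have "c x d m = m" by simp
      then have "c x m d = m" unfolding perm(1)[OF xy(1) d(2) m] .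
      with d(3,4) show False by simp
    qed
    have "d \<in> D \<inter> tree_interval T c r x" "d \<notin> D \<inter> tree_interval T c r y"
      using 1 2 d by (auto simp: tree_interval_def)
    then have "to_nat_on D d \<in> f x" "to_nat_on D d \<notin> f y"
      using inj_on_to_nat_on[OF D(2)] d(1) by (auto simp: f_def inj_on_def)
    then show ?thesis by blast
  qed
  have "inj_on f T"
  proof (rule inj_onI, rule ccontr)
    fix x y assume *: "x \<in> T" "y \<in> T" "f x = f y" "x \<noteq> y"
    have "c r x y = x" using sep[OF *(1,2)] *(3) by blast
    moreover have "c r y x = y" using sep[OF *(2,1)] *(3) by metis
    ultimately show False using sym23[OF r *(1,2)] *(4) by simp
  qed
  then show ?thesis by blast
qed

end

theory Submission
  imports Defs
begin

text \<open>Write \<open>r\<close> for the metric of the branch point distribution \<open>\<nu>\<close>, and let \<open>v\<close> be the branch point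
  of \<open>x\<^sub>0, x\<^sub>1, x\<^sub>2\<close> in a binary tree with atoms restricted to leaves. If
  \<open>r(x\<^sub>i, v) > k\<close>, then the component of \<open>x\<^sub>i\<close> at \<open>v\<close> has mass at least \<open>k / 3\<close>.
  Conversely, \<open>\<nu>{v}\<close> is at least the product of the masses of any three components at \<open>v\<close>,
  and \<open>\<nu>[w, v]\<close> is at least the product of the masses beyond \<open>w\<close>, beyond \<open>v\<close>, and between
  them. As \<open>\<nu>[w, v] \<le> 2 r(w, v)\<close> for \<open>w \<noteq> v\<close>, the points \<open>x\<^sub>3\<close> that form with
  \<open>x\<^sub>0, x\<^sub>1, x\<^sub>2\<close> a star up to an error \<open>e\<close>, with arms of length more than \<open>k\<close> for
  \<open>x\<^sub>0\<close> and \<open>x\<^sub>1\<close>, have total mass \<open>O(e / k\<^sup>3)\<close>.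

  In a tree that has four components of positive mass at some point, or two of them at an atom, four
  random points form an exact star of this kind with a positive probability that does not
  depend on \<open>e\<close>. Hence a continuous test function of the distance matrix of four points separates such a tree
  from all binary trees with atoms restricted to leaves. In every other tree, removing all
  components of mass zero leaves an equivalent binary tree whose atoms are leaves.\<close>

section \<open>Betweenness and components\<close>

context algebraic_tree
begin

text \<open>The point v lies on the interval from x to y, written with v in the middle. Positions
  are compared through this relation, which hides the argument order of \<open>c\<close>.\<close>

definition between :: "'a \<Rightarrow> 'a \<Rightarrow> 'a \<Rightarrow> bool" where
  "between x v y \<longleftrightarrow> c x y v = v"

lemma c_rotate: "\<lbrakk>x \<in> T; y \<in> T; z \<in> T\<rbrakk> \<Longrightarrow> c x y z = c y z x"
  using sym12 sym23 by metis

lemma between_commute: "\<lbrakk>x \<in> T; v \<in> T; y \<in> T\<rbrakk> \<Longrightarrow> between x v y \<longleftrightarrow> between y v x"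
  by (simp add: between_def sym12)

lemma between_left [simp]: "\<lbrakk>x \<in> T; y \<in> T\<rbrakk> \<Longrightarrow> between x x y"
  using two_point[of y x] c_rotate[of x y x] by (simp add: between_def)

lemma between_right [simp]: "\<lbrakk>x \<in> T; y \<in> T\<rbrakk> \<Longrightarrow> between x y y"
  by (simp add: between_def two_point)

lemma between_same: "\<lbrakk>x \<in> T; v \<in> T; between x v x\<rbrakk> \<Longrightarrow> v = x"
  using two_point[of v x] c_rotate[of v x x] by (simp add: between_def)

lemma between_antisym: "\<lbrakk>x \<in> T; u \<in> T; v \<in> T; between x u v; between x v u\<rbrakk> \<Longrightarrow> u = v"
  using sym23[of x u v] by (simp add: between_def)

text \<open>The four point axiom as [x,z] \<subseteq> [x,y] \<union> [y,z]: with y as fourth point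
  it equates \<open>c x z v\<close> with one of three branch points, each lying on one of the two
  intervals on the right. Most later arguments about positions are instances of this.\<close>

lemma between_cases:
  assumes "x \<in> T" "y \<in> T" "z \<in> T" "v \<in> T" "between x v z"
  shows "between x v y \<or> between y v z"
proof -
  have "c x z v \<in> {c x z y, c x v y, c z v y}"
    using assms four_point by blast
  then consider "c x z y = v" | "c x v y = v" | "c z v y = v"
    using assms(5) by (auto simp: between_def)
  then show ?thesis
  proof cases
    case 1
    then have "c x y z = v" using sym23 assms by metis
    then show ?thesis using three_point[OF assms(1-3)] by (simp add: between_def)
  next
    case 2
    then show ?thesis using sym23 assms by (auto simp: between_def)
  next
    case 3
    then show ?thesis using sym23 sym12 assms by (auto simp: between_def)
  qed
qed

text \<open>Splitting [x,y] at v puts m on [x,v] or on [v,y]; since v also lies on [x,m] and [m,y],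
  antisymmetry applies in both cases.\<close>

lemma between_unique:
  assumes "x \<in> T" "y \<in> T" "m \<in> T" "v \<in> T" "between x v m" "between m v y" "between x m y"
  shows "v = m"
proof -
  have "between x m v \<or> between v m y"
    using assms between_cases[of x v y m] by blast
  then show ?thesis
    using assms between_antisym[of x v m] between_antisym[of y v m]
      between_commute[of m v y] between_commute[of v m y] by blast
qed

lemma median_between:
  assumes "x \<in> T" "y \<in> T" "z \<in> T"
  shows "between x (c x y z) y" "between y (c x y z) z" "between x (c x y z) z"
proof -
  show "between x (c x y z) y"
    using three_point[OF assms] by (simp add: between_def)
  show "between y (c x y z) z"
    using three_point[of y z x] c_rotate[OF assms] assms by (simp add: between_def)
  show "between x (c x y z) z"
    using three_point[of x z y] sym23[OF assms] assms by (simp add: between_def)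
qed

text \<open>With m as the fourth point, the four point axiom offers only m as a value.\<close>

lemma median_eqI:
  assumes "x \<in> T" "y \<in> T" "z \<in> T" "m \<in> T"
    and "between x m y" "between y m z" "between x m z"
  shows "c x y z = m"
  using four_point[OF assms(1-4)] assms(5-7) by (auto simp: between_def)

text \<open>If u were off [x,y], splitting [x,z] at y would put u on [y,z] as well; the intervals
  [x,z] and [z,y] meet only in z, which is on [x,y].\<close>

lemma between_trans_left:
  assumes "x \<in> T" "y \<in> T" "z \<in> T" "u \<in> T" "between x z y" "between x u z"
  shows "between x u y"
proof (rule ccontr)
  assume "\<not> between x u y"
  then have "between y u z" using assms between_cases[of x y z u] by blast
  then have "u = z"
    using assms between_unique[of x y z u] between_commute[of y u z] by blast
  then show False using assms \<open>\<not> between x u y\<close> by simp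
qed

lemma between_trans_right:
  assumes "x \<in> T" "y \<in> T" "z \<in> T" "u \<in> T" "between x z y" "between z u y"
  shows "between x u y"
  using assms between_trans_left[of y x z u] between_commute by simp

lemma mem_interval: "z \<in> tree_interval T c x y \<longleftrightarrow> z \<in> T \<and> between x z y"
  by (simp add: tree_interval_def between_def)

lemma interval_same: "x \<in> T \<Longrightarrow> tree_interval T c x x = {x}"
  using between_same by (auto simp: mem_interval)

lemma interval_Un:
  assumes "x \<in> T" "y \<in> T" "z \<in> T" "between x z y"
  shows "tree_interval T c x y = tree_interval T c x z \<union> tree_interval T c z y"
proof -
  have "between x u y \<longleftrightarrow> between x u z \<or> between z u y" if "u \<in> T" for u
    using assms that between_cases[of x z y u] between_trans_left[of x y z u]
      between_trans_right[of x y z u] by blast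
  then show ?thesis
    unfolding set_eq_iff Un_iff mem_interval by blast
qed

lemma interval_Int:
  assumes "x \<in> T" "y \<in> T" "z \<in> T" "between x z y"
  shows "tree_interval T c x z \<inter> tree_interval T c z y = {z}"
  using assms between_unique[of x y z] by (auto simp: mem_interval)

section \<open>Components and their convexity\<close>

lemma mem_component:
  assumes "v \<in> T" "y \<in> T"
  shows "z \<in> tree_component T c v y \<longleftrightarrow> z \<in> T \<and> z \<noteq> v \<and> \<not> between y v z"
  using assms c_rotate[of v y z] by (auto simp: tree_component_def between_def)

lemma component_self: "\<lbrakk>v \<in> T; y \<in> T; y \<noteq> v\<rbrakk> \<Longrightarrow> y \<in> tree_component T c v y"
  using between_same by (auto simp: mem_component)

lemma component_subset: "tree_component T c v y \<subseteq> T"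
  by (auto simp: tree_component_def)

lemma component_cong:
  assumes "v \<in> T" "y \<in> T" "z \<in> tree_component T c v y"
  shows "tree_component T c v z = tree_component T c v y"
proof -
  have z: "z \<in> T" "z \<noteq> v" "\<not> between y v z" "\<not> between z v y"
    using assms mem_component between_commute by auto
  have "between z v u \<longleftrightarrow> between y v u" if "u \<in> T" for u
    using z assms that between_cases[of z y u v] between_cases[of y z u v] by blast
  then show ?thesis
    unfolding set_eq_iff mem_component[OF assms(1) z(1)] mem_component[OF assms(1,2)] by blast
qed

lemma component_eq_iff:
  assumes "v \<in> T" "x \<in> T" "y \<in> T" "x \<noteq> v" "y \<noteq> v"
  shows "tree_component T c v x = tree_component T c v y \<longleftrightarrow> \<not> between x v y"
  using assms component_cong component_self mem_component by metis

text \<open>If m were outside, v would lie on [x,m] and on [m,y]; uniqueness then gives v = m, which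
  puts v between two points of one component.\<close>

lemma component_convex:
  assumes "v \<in> T" "w \<in> T" "x \<in> tree_component T c v w" "y \<in> tree_component T c v w"
    and "m \<in> T" "between x m y"
  shows "m \<in> tree_component T c v w"
proof -
  have T: "x \<in> T" "y \<in> T" "x \<noteq> v" "y \<noteq> v" "\<not> between w v x" "\<not> between w v y"
    using assms mem_component by auto
  have "\<not> between x v y"
    using T assms between_cases[of x w y v] between_commute[of x v w] by blast
  moreover have "\<not> between w v m"
  proof
    assume "between w v m"
    then have "between x v m" "between m v y"
      using T assms between_cases[of w x m v] between_cases[of w y m v]
        between_commute[of m v y] by blast+
    then have "v = m"
      using between_unique[of x y m v] T assms by blast
    then show False
      using \<open>\<not> between x v y\<close> assms by simp
  qed
  ultimately show ?thesis
    using assms T by (auto simp: mem_component)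
qed

text \<open>A point m of the component is separated by v from x and from y, so v lies on [x,m] and
  on [m,y] and equals m, which the component excludes.\<close>

lemma co_component_convex:
  assumes "v \<in> T" "w \<in> T" "x \<in> T - tree_component T c v w" "y \<in> T - tree_component T c v w"
    and "m \<in> T" "between x m y"
  shows "m \<notin> tree_component T c v w"
proof
  assume "m \<in> tree_component T c v w"
  then have m: "m \<noteq> v" "\<not> between w v m"
    using assms mem_component by auto
  have T: "x \<in> T" "y \<in> T" "x = v \<or> between w v x" "y = v \<or> between w v y"
    using assms mem_component by auto
  have "between x v m"
    using T(1-4) m assms(1,2,5) between_cases[of w m x v] between_commute[of m v x] between_left[of v m] by auto
  moreover have "between m v y"
    using T(1-4) m assms(1,2,5) between_cases[of w m y v] between_right[of m v] by auto
  ultimately show False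
    using between_unique[of x y m v] T assms m by simp
qed

text \<open>Majority rule: the median lies between each pair of its arguments, and a component and
  its complement are both convex, so two points on the same side decide.\<close>

lemma median_in_component_iff:
  assumes "v \<in> T" "w \<in> T" "x \<in> T" "y \<in> T" "z \<in> T"
  shows "c x y z \<in> tree_component T c v w \<longleftrightarrow>
    (x \<in> tree_component T c v w \<and> y \<in> tree_component T c v w) \<or>
    (y \<in> tree_component T c v w \<and> z \<in> tree_component T c v w) \<or>
    (x \<in> tree_component T c v w \<and> z \<in> tree_component T c v w)" (is "?m \<in> ?S \<longleftrightarrow> _")
proof -
  note m = closed[OF assms(3-5)] median_between[OF assms(3-5)]
  note conv = component_convex[OF assms(1,2) _ _ m(1)]
  note coconv = co_component_convex[OF assms(1,2) _ _ m(1)]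
  have "x \<in> ?S \<Longrightarrow> y \<in> ?S \<Longrightarrow> ?m \<in> ?S" "x \<in> ?S \<Longrightarrow> z \<in> ?S \<Longrightarrow> ?m \<in> ?S"
    "y \<in> ?S \<Longrightarrow> z \<in> ?S \<Longrightarrow> ?m \<in> ?S"
    using conv[OF _ _ m(2)] conv[OF _ _ m(3)] conv[OF _ _ m(4)] by blast+
  moreover have "x \<notin> ?S \<Longrightarrow> y \<notin> ?S \<Longrightarrow> ?m \<notin> ?S" "x \<notin> ?S \<Longrightarrow> z \<notin> ?S \<Longrightarrow> ?m \<notin> ?S"
    "y \<notin> ?S \<Longrightarrow> z \<notin> ?S \<Longrightarrow> ?m \<notin> ?S"
    using coconv[OF _ _ m(2)] coconv[OF _ _ m(3)] coconv[OF _ _ m(4)] assms(3-5) by blast+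
  ultimately show ?thesis by blast
qed

end

section \<open>The Borel sets of an order separable tree\<close>

definition tree_components :: "'a set \<Rightarrow> ('a \<Rightarrow> 'a \<Rightarrow> 'a \<Rightarrow> 'a) \<Rightarrow> 'a set set" where
  "tree_components T c = {tree_component T c x y |x y. x \<in> T \<and> y \<in> T \<and> x \<noteq> y}"

locale order_separable_tree = algebraic_tree +
  assumes order_separable: "order_separable T c"
begin

lemma tree_components_subset: "tree_components T c \<subseteq> Pow T"
  using component_subset by (auto simp: tree_components_def)

text \<open>The base consists of the components \<open>tree_component T c d e\<close> with d and e
  in a countable order dense set D: moving the cut point from v towards z shrinks the component that
  contains z.\<close>

lemma countable_component_base:
  "\<exists>\<B>. countable \<B> \<and> \<B> \<subseteq> tree_components T c \<and>
    (\<forall>S\<in>tree_components T c. \<forall>z\<in>S. \<exists>U\<in>\<B>. z \<in> U \<and> U \<subseteq> S)"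
proof -
  obtain D where D: "D \<subseteq> T" "countable D"
    and dense: "\<And>x y. x \<in> T \<Longrightarrow> y \<in> T \<Longrightarrow> x \<noteq> y \<Longrightarrow> D \<inter> (tree_interval T c x y - {y}) \<noteq> {}"
    using order_separable unfolding order_separable_def by metis
  define \<B> where "\<B> = (\<lambda>(d, e). tree_component T c d e) ` ((D \<times> D) - Id)"
  have "countable \<B>" unfolding \<B>_def using D(2) by blast
  moreover have "\<B> \<subseteq> tree_components T c"
    using D(1) by (auto simp: \<B>_def tree_components_def)
  moreover have "\<exists>U\<in>\<B>. z \<in> U \<and> U \<subseteq> S" if S: "S \<in> tree_components T c" and z: "z \<in> S" for S z
  proof -
    obtain v w where v: "v \<in> T" "w \<in> T" "S = tree_component T c v w"
      using S by (auto simp: tree_components_def)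
    have zT: "z \<in> T" "z \<noteq> v" and Sz: "S = tree_component T c v z"
      using z component_cong[OF v(1,2)] unfolding v(3) by (auto simp: mem_component[OF v(1,2)])
    \<comment> \<open>The new cut point d lies on [v,z). As z may be outside D, the point e on [z,d)
      is used to name the component of z at d.\<close>
    obtain d where "d \<in> D" and d: "d \<in> T" "between v d z" "d \<noteq> z"
      using dense[OF v(1) zT(1)] zT(2) mem_interval by blast
    obtain e where "e \<in> D" and e: "e \<in> T" "between z e d" "e \<noteq> d"
      using dense[OF zT(1) d(1)] d(3) mem_interval by blast
    have "\<not> between e d z"
      using between_antisym[OF zT(1) d(1) e(1)] between_commute[OF e(1) d(1) zT(1)] e by blast
    then have ze: "z \<in> tree_component T c d e"
      using d e zT by (simp add: mem_component)
    then have eq: "tree_component T c d e = tree_component T c d z"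
      using component_cong[OF d(1) e(1)] by simp
    have "u \<in> S" if "u \<in> tree_component T c d z" for u
    proof -
      have u: "u \<in> T" "\<not> between z d u" using that d zT by (simp_all add: mem_component)
      have zdv: "between z d v" using d(2) between_commute[OF v(1) d(1) zT(1)] by blast
      then have "\<not> between z v u"
        using between_trans_left[OF zT(1) u(1) v(1) d(1)] u(2) by blast
      moreover have "u \<noteq> v" using u zdv by blast
      ultimately show ?thesis using u zT v(1) unfolding Sz by (simp add: mem_component)
    qed
    then show ?thesis
      using \<open>d \<in> D\<close> \<open>e \<in> D\<close> e(3) ze eq by (auto simp: \<B>_def intro!: bexI[of _ "(d, e)"])
  qed
  ultimately show ?thesis by blast
qed

text \<open>Order separability makes the component topology second countable, so that the Borel
  \<open>\<sigma>\<close>-algebra is already generated by the components.\<close>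

lemma sets_tree_borel: "sets (tree_borel T c) = sigma_sets T (tree_components T c)"
proof -
  let ?C = "tree_components T c"
  let ?O = "{U. openin (component_topology T c) U}"
  have gen: "openin (component_topology T c) U \<longleftrightarrow> generate_topology_on (insert T ?C) U" for U
    by (simp add: component_topology_def tree_components_def openin_topology_generated_by_iff)
  have "topspace (component_topology T c) = T"
    using tree_components_subset
    by (auto simp: component_topology_def topology_generated_by_topspace tree_components_def)
  then have O: "?O \<subseteq> Pow T" using openin_subset by fastforce
  obtain \<B> where \<B>: "countable \<B>" "\<B> \<subseteq> ?C"
    "\<And>S z. S \<in> ?C \<Longrightarrow> z \<in> S \<Longrightarrow> \<exists>U\<in>\<B>. z \<in> U \<and> U \<subseteq> S"
    using countable_component_base by metis
  \<comment> \<open>Around each of its points an open set contains a finite intersection of base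
    components; the empty intersection accounts for the generator T.\<close>
  have base: "\<exists>F. finite F \<and> F \<subseteq> \<B> \<and> z \<in> T \<inter> \<Inter>F \<and> T \<inter> \<Inter>F \<subseteq> U"
    if "generate_topology_on (insert T ?C) U" "z \<in> U" for U z
    using that
  proof (induction arbitrary: z rule: generate_topology_on.induct)
    case Empty
    then show ?case by simp
  next
    case (Int a b)
    obtain F where F: "finite F" "F \<subseteq> \<B>" "z \<in> T \<inter> \<Inter>F" "T \<inter> \<Inter>F \<subseteq> a"
      using Int.IH(1)[of z] Int.prems by auto
    obtain G where "finite G" "G \<subseteq> \<B>" "z \<in> T \<inter> \<Inter>G" "T \<inter> \<Inter>G \<subseteq> b"
      using Int.IH(2)[of z] Int.prems by auto
    with F show ?case by (intro exI[of _ "F \<union> G"]) auto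
  next
    case (UN K)
    then show ?case by (meson UnionE Union_upper order_trans)
  next
    case (Basis s)
    then consider "s = T" | "s \<in> ?C" by auto
    then show ?case
    proof cases
      case 1
      then show ?thesis using Basis by (intro exI[of _ "{}"]) auto
    next
      case 2
      then obtain U where "U \<in> \<B>" "z \<in> U" "U \<subseteq> s" using \<B>(3) Basis by blast
      then show ?thesis
        using tree_components_subset 2 Basis by (intro exI[of _ "{U}"]) auto
    qed
  qed
  have "U \<in> sigma_sets T ?C" if "U \<in> ?O" for U
  proof -
    let ?F = "{F. finite F \<and> F \<subseteq> \<B> \<and> T \<inter> \<Inter>F \<subseteq> U}"
    have "U = (\<Union>F\<in>?F. T \<inter> \<Inter>F)"
    proof
      show "U \<subseteq> (\<Union>F\<in>?F. T \<inter> \<Inter>F)"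
      proof
        fix z assume "z \<in> U"
        moreover have "generate_topology_on (insert T ?C) U"
          using that gen[of U] by simp
        ultimately obtain F where "finite F" "F \<subseteq> \<B>" "z \<in> T \<inter> \<Inter>F" "T \<inter> \<Inter>F \<subseteq> U"
          using base by metis
        then show "z \<in> (\<Union>F\<in>?F. T \<inter> \<Inter>F)" by (intro UN_I[of F] CollectI conjI)
      qed
    qed auto
    moreover have "countable ?F"
      using countable_Collect_finite_subset[OF \<B>(1)] by (rule countable_subset[rotated]) auto
    moreover interpret sigma_algebra T "sigma_sets T ?C"
      using tree_components_subset by (rule sigma_algebra_sigma_sets)
    have "T \<inter> \<Inter>F \<in> sigma_sets T ?C" if "finite F" "F \<subseteq> \<B>" for F
      using that
    proof (induction F rule: finite_induct)
      case (insert S F)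
      then have "S \<in> sigma_sets T ?C" using \<B>(2) by auto
      then have "S \<inter> (T \<inter> \<Inter>F) \<in> sigma_sets T ?C" using insert by blast
      then show ?case by (simp add: Int_ac)
    qed auto
    ultimately show ?thesis
      by (metis (no_types, lifting) countable_UN'' mem_Collect_eq)
  qed
  moreover have "?C \<subseteq> ?O"
    by (auto simp: gen intro: generate_topology_on.Basis)
  ultimately have "sigma_sets T ?O = sigma_sets T ?C"
    by (intro sigma_sets_eqI) auto
  then show ?thesis
    by (simp add: tree_borel_def sets_measure_of O)
qed

end

section \<open>Measurability of branch points, equality and intervals\<close>

locale measure_tree = order_separable_tree T c + prob_space M
  for T :: "'a set" and c :: "'a \<Rightarrow> 'a \<Rightarrow> 'a \<Rightarrow> 'a" and M :: "'a measure" +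
  assumes space_M: "space M = T"
    and sets_M: "sets M = sets (tree_borel T c)"
begin

lemma component_sets [measurable]:
  "\<lbrakk>v \<in> T; w \<in> T; v \<noteq> w\<rbrakk> \<Longrightarrow> tree_component T c v w \<in> sets M"
  unfolding sets_M sets_tree_borel by (auto simp: tree_components_def)

text \<open>Components generate the Borel sets, and by the majority rule the preimage of a component
  is a Boolean combination of its preimages under f, g and h.\<close>

lemma measurable_median [measurable (raw)]:
  assumes f: "f \<in> N \<rightarrow>\<^sub>M M" and g: "g \<in> N \<rightarrow>\<^sub>M M" and h: "h \<in> N \<rightarrow>\<^sub>M M"
  shows "(\<lambda>\<omega>. c (f \<omega>) (g \<omega>) (h \<omega>)) \<in> N \<rightarrow>\<^sub>M M"
proof (rule measurable_sigma_sets)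
  show "sets M = sigma_sets T (tree_components T c)"
    by (simp add: sets_M sets_tree_borel)
  show "tree_components T c \<subseteq> Pow T" by (rule tree_components_subset)
  have T: "f \<omega> \<in> T" "g \<omega> \<in> T" "h \<omega> \<in> T" if "\<omega> \<in> space N" for \<omega>
    using that f g h space_M by (auto dest: measurable_space)
  then show "(\<lambda>\<omega>. c (f \<omega>) (g \<omega>) (h \<omega>)) \<in> space N \<rightarrow> T"
    using closed by auto
  fix S assume "S \<in> tree_components T c"
  then obtain v w where v: "v \<in> T" "w \<in> T" "v \<noteq> w" "S = tree_component T c v w"
    by (auto simp: tree_components_def)
  then have [measurable]: "S \<in> sets M" by simp
  note [measurable] = f g h
  have "(\<lambda>\<omega>. c (f \<omega>) (g \<omega>) (h \<omega>)) -` S \<inter> space N = {\<omega>\<in>space N. (f \<omega> \<in> S \<and> g \<omega> \<in> S) \<or>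
      (g \<omega> \<in> S \<and> h \<omega> \<in> S) \<or> (f \<omega> \<in> S \<and> h \<omega> \<in> S)}"
    using T v(1,2) by (auto simp: v(4) median_in_component_iff)
  also have "\<dots> \<in> sets N" by measurable
  finally show "(\<lambda>\<omega>. c (f \<omega>) (g \<omega>) (h \<omega>)) -` S \<inter> space N \<in> sets N" .
qed

text \<open>Countably many components separate points, so equality becomes a countable conjunction
  of measurable conditions.\<close>

lemma pred_eq [measurable (raw)]:
  assumes f [measurable]: "f \<in> N \<rightarrow>\<^sub>M M" and g [measurable]: "g \<in> N \<rightarrow>\<^sub>M M"
  shows "Measurable.pred N (\<lambda>\<omega>. f \<omega> = g \<omega>)"
proof -
  obtain \<B> where \<B>: "countable \<B>" "\<B> \<subseteq> tree_components T c"
    "\<And>S z. S \<in> tree_components T c \<Longrightarrow> z \<in> S \<Longrightarrow> \<exists>U\<in>\<B>. z \<in> U \<and> U \<subseteq> S"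
    using countable_component_base by metis
  have "\<exists>U\<in>\<B>. x \<notin> U \<and> y \<in> U" if "x \<in> T" "y \<in> T" "x \<noteq> y" for x y
  proof -
    have "tree_component T c x y \<in> tree_components T c" "y \<in> tree_component T c x y"
      using that component_self by (auto simp: tree_components_def)
    then obtain U where "U \<in> \<B>" "y \<in> U" "U \<subseteq> tree_component T c x y"
      using \<B>(3) by blast
    moreover have "x \<notin> tree_component T c x y" by (simp add: tree_component_def)
    ultimately show ?thesis by blast
  qed
  then have "(f \<omega> = g \<omega>) \<longleftrightarrow> (\<forall>U\<in>\<B>. g \<omega> \<in> U \<longrightarrow> f \<omega> \<in> U)" if "\<omega> \<in> space N" for \<omega>
    using measurable_space[OF f that] measurable_space[OF g that] space_M by metis
  moreover have "Measurable.pred N (\<lambda>\<omega>. \<forall>U\<in>\<B>. g \<omega> \<in> U \<longrightarrow> f \<omega> \<in> U)"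
  proof -
    have [measurable]: "U \<in> sets M" if "U \<in> \<B>" for U
      using that \<B>(2) by (auto simp: tree_components_def)
    show ?thesis using \<B>(1) by measurable
  qed
  ultimately show ?thesis by (simp cong: measurable_cong)
qed

lemma pred_between [measurable (raw)]:
  assumes [measurable]: "f \<in> N \<rightarrow>\<^sub>M M" "g \<in> N \<rightarrow>\<^sub>M M" "h \<in> N \<rightarrow>\<^sub>M M"
  shows "Measurable.pred N (\<lambda>\<omega>. between (f \<omega>) (g \<omega>) (h \<omega>))"
  unfolding between_def by measurable

lemma singleton_sets [measurable]: "x \<in> T \<Longrightarrow> {x} \<in> sets M"
proof -
  assume [measurable]: "x \<in> T"
  have "x \<in> space M" using \<open>x \<in> T\<close> space_M by simp
  then have "{y\<in>space M. y = x} \<in> sets M" by measurable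
  moreover have "{y\<in>space M. y = x} = {x}" using \<open>x \<in> space M\<close> by auto
  ultimately show ?thesis by simp
qed

lemma interval_sets [measurable]: "\<lbrakk>x \<in> T; y \<in> T\<rbrakk> \<Longrightarrow> tree_interval T c x y \<in> sets M"
proof -
  assume "x \<in> T" "y \<in> T"
  then have "x \<in> space M" "y \<in> space M" using space_M by auto
  then have "{z\<in>space M. between x z y} \<in> sets M" by measurable
  moreover have "{z\<in>space M. between x z y} = tree_interval T c x y"
    by (auto simp: mem_interval space_M)
  ultimately show ?thesis by simp
qed

end

section \<open>The metric of the branch point distribution\<close>

context measure_tree
begin

abbreviation \<nu> :: "'a measure" where
  "\<nu> \<equiv> branch_point_distribution c M"

abbreviation d :: "'a \<Rightarrow> 'a \<Rightarrow> real" where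
  "d \<equiv> bpd_dist (T, c, M)"

abbreviation M3 :: "('a \<times> 'a \<times> 'a) measure" where
  "M3 \<equiv> M \<Otimes>\<^sub>M (M \<Otimes>\<^sub>M M)"

lemma space_\<nu> [simp]: "space \<nu> = T" and sets_\<nu> [simp, measurable_cong]: "sets \<nu> = sets M"
  by (simp_all add: branch_point_distribution_def space_M)

lemma space_M3: "space M3 = T \<times> T \<times> T"
  by (simp add: space_pair_measure space_M)

lemma prob_space_M3: "prob_space M3"
  by (intro prob_space_pair prob_space_axioms)

lemma median_M3 [measurable]: "(\<lambda>(x, y, z). c x y z) \<in> M3 \<rightarrow>\<^sub>M M"
  by measurable

sublocale \<nu>: prob_space \<nu>
  unfolding branch_point_distribution_def
  using prob_space.prob_space_distr[OF prob_space_M3 median_M3] .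

lemma measure_\<nu>:
  "B \<in> sets M \<Longrightarrow> measure \<nu> B = measure M3 {p\<in>space M3. (\<lambda>(x, y, z). c x y z) p \<in> B}"
  unfolding branch_point_distribution_def
  by (subst measure_distr[OF median_M3]) (auto intro!: arg_cong[where f="measure M3"])

lemma measure_M3_Times:
  assumes [measurable]: "A \<in> sets M" "B \<in> sets M" "C \<in> sets M"
  shows "measure M3 (A \<times> B \<times> C) = measure M A * measure M B * measure M C"
proof -
  interpret MM: prob_space "M \<Otimes>\<^sub>M M" by (intro prob_space_pair prob_space_axioms)
  show ?thesis
    by (simp add: measure_def MM.emeasure_pair_measure_Times emeasure_pair_measure_Times
        enn2real_mult mult.assoc)
qed

text \<open>The box A * B * C has product mass, and all branch points of its triples fall into
  J.\<close>

lemma \<nu>_lower: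
  assumes [measurable]: "A \<in> sets M" "B \<in> sets M" "C \<in> sets M" "J \<in> sets M"
    and sub: "\<And>x y z. x \<in> A \<Longrightarrow> y \<in> B \<Longrightarrow> z \<in> C \<Longrightarrow> c x y z \<in> J"
  shows "measure M A * measure M B * measure M C \<le> measure \<nu> J"
proof -
  interpret M3: prob_space M3 by (rule prob_space_M3)
  have "{p\<in>space M3. (\<lambda>(x, y, z). c x y z) p \<in> J} \<in> sets M3" by measurable
  moreover have "A \<subseteq> T" "B \<subseteq> T" "C \<subseteq> T" using assms sets.sets_into_space space_M by metis+
  ultimately have "measure M3 (A \<times> B \<times> C) \<le> measure \<nu> J"
    using sub unfolding measure_\<nu>[OF assms(4)]
    by (intro M3.finite_measure_mono) (auto simp: space_M3 subset_iff)
  then show ?thesis using measure_M3_Times[OF assms(1-3)] by simp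
qed

text \<open>Union bound: a branch point in J requires one of the three samples to lie in A.\<close>

lemma \<nu>_upper:
  assumes [measurable]: "A \<in> sets M" "J \<in> sets M"
    and sub: "\<And>x y z. x \<in> T - A \<Longrightarrow> y \<in> T - A \<Longrightarrow> z \<in> T - A \<Longrightarrow> c x y z \<notin> J"
  shows "measure \<nu> J \<le> 3 * measure M A"
proof -
  interpret M3: prob_space M3 by (rule prob_space_M3)
  have [measurable]: "T \<in> sets M" using sets.top[of M] space_M by simp
  have T1: "measure M T = 1" using prob_space space_M by simp
  have "measure \<nu> J \<le> measure M3 (A \<times> T \<times> T \<union> T \<times> A \<times> T \<union> T \<times> T \<times> A)"
    unfolding measure_\<nu>[OF assms(2)]
  proof (rule M3.finite_measure_mono)
    show "{p\<in>space M3. (\<lambda>(x, y, z). c x y z) p \<in> J} \<subseteq> A \<times> T \<times> T \<union> T \<times> A \<times> T \<union> T \<times> T \<times> A"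
      using sub by (auto simp: space_M3)
  qed simp
  also have "\<dots> \<le> measure M3 (A \<times> T \<times> T) + measure M3 (T \<times> A \<times> T) + measure M3 (T \<times> T \<times> A)"
    by (intro order_trans[OF measure_Un_le] add_right_mono
        measure_Un_le) simp_all
  finally show ?thesis by (simp add: measure_M3_Times T1)
qed

lemma d_eq: "d x y = measure \<nu> (tree_interval T c x y) - measure \<nu> {x} / 2 - measure \<nu> {y} / 2"
  by (simp add: bpd_dist_def Let_def)

lemma d_same: "x \<in> T \<Longrightarrow> d x x = 0"
  by (simp add: d_eq interval_same)

lemma d_commute: "x \<in> T \<Longrightarrow> y \<in> T \<Longrightarrow> d x y = d y x"
proof -
  assume "x \<in> T" "y \<in> T"
  then have "tree_interval T c x y = tree_interval T c y x"
    using between_commute[of x _ y] by (auto simp: mem_interval)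
  then show ?thesis by (simp add: d_eq)
qed

text \<open>This is the purpose of the half weights in \<open>bpd_dist\<close>: z is counted in both
  subintervals, and its two half weights remove exactly one copy.\<close>

lemma d_additive:
  assumes [simp]: "x \<in> T" "y \<in> T" "z \<in> T" and z: "between x z y"
  shows "d x y = d x z + d z y"
proof -
  have "measure \<nu> (tree_interval T c x y) =
      measure \<nu> (tree_interval T c x z) + measure \<nu> (tree_interval T c z y) - measure \<nu> {z}"
    using measure_Un3[of "tree_interval T c x z" \<nu> "tree_interval T c z y"]
    by (simp add: interval_Un[OF assms] interval_Int[OF assms] fmeasurable_def
        \<nu>.emeasure_finite less_top[symmetric])
  then show ?thesis by (simp add: d_eq)
qed

text \<open>Distinct endpoints together have at most the mass of the interval, so subtracting half
  of their mass leaves at least half of it.\<close>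

lemma \<nu>_interval_le:
  assumes [simp]: "x \<in> T" "y \<in> T" and "x \<noteq> y"
  shows "measure \<nu> (tree_interval T c x y) \<le> 2 * d x y"
proof -
  have "measure \<nu> {x} + measure \<nu> {y} = measure \<nu> ({x} \<union> {y})"
    using assms by (intro \<nu>.finite_measure_Union[symmetric]) auto
  also have "\<dots> \<le> measure \<nu> (tree_interval T c x y)"
    by (intro \<nu>.finite_measure_mono) (auto simp: mem_interval)
  finally show ?thesis by (simp add: d_eq)
qed

lemma \<nu>_singleton_le:
  assumes [simp]: "x \<in> T" "y \<in> T" and "x \<noteq> y" "z \<in> T" "between x z y"
  shows "measure \<nu> {z} \<le> 2 * d x y"
proof -
  have "measure \<nu> {z} \<le> measure \<nu> (tree_interval T c x y)"
    using assms by (intro \<nu>.finite_measure_mono) (auto simp: mem_interval)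
  then show ?thesis using \<nu>_interval_le[OF assms(1-3)] by simp
qed

lemma d_le_\<nu>: "d x y \<le> measure \<nu> (tree_interval T c x y)"
  unfolding d_eq using measure_nonneg[of \<nu> "{x}"] measure_nonneg[of \<nu> "{y}"] by argo

lemma d_le_1: "d x y \<le> 1"
  using d_le_\<nu> \<nu>.prob_le_1 order_trans by blast

lemma measurable_d [measurable (raw)]:
  assumes [measurable]: "f \<in> N \<rightarrow>\<^sub>M M" "g \<in> N \<rightarrow>\<^sub>M M"
  shows "(\<lambda>\<omega>. d (f \<omega>) (g \<omega>)) \<in> borel_measurable N"
proof -
  have T: "f \<omega> \<in> T" "g \<omega> \<in> T" if "\<omega> \<in> space N" for \<omega>
    using that assms[THEN measurable_space] space_M by simp_all
  \<comment> \<open>Intervals and singletons are sections of measurable sets of pairs, so their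
    masses depend measurably on the parameter.\<close>
  have meas: "(\<lambda>\<omega>. measure \<nu> {z\<in>space \<nu>. P \<omega> z}) \<in> borel_measurable N"
    if [measurable]: "Measurable.pred (N \<Otimes>\<^sub>M \<nu>) (\<lambda>(\<omega>, z). P \<omega> z)" for P
  proof -
    let ?Q = "{p\<in>space (N \<Otimes>\<^sub>M \<nu>). (\<lambda>(\<omega>, z). P \<omega> z) p}"
    have "?Q \<in> sets (N \<Otimes>\<^sub>M \<nu>)" by measurable
    then have "(\<lambda>\<omega>. emeasure \<nu> (Pair \<omega> -` ?Q)) \<in> borel_measurable N"
      by (rule \<nu>.measurable_emeasure_Pair)
    then have "(\<lambda>\<omega>. measure \<nu> (Pair \<omega> -` ?Q)) \<in> borel_measurable N"
      unfolding measure_def by measurable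
    moreover have "Pair \<omega> -` ?Q = {z\<in>space \<nu>. P \<omega> z}" if "\<omega> \<in> space N" for \<omega>
      using that by (auto simp: space_pair_measure)
    ultimately show ?thesis by (simp cong: measurable_cong)
  qed
  have 1: "(\<lambda>\<omega>. measure \<nu> {z\<in>space \<nu>. between (f \<omega>) z (g \<omega>)}) \<in> borel_measurable N"
    by (rule meas) measurable
  have 2: "(\<lambda>\<omega>. measure \<nu> {z\<in>space \<nu>. z = h \<omega>}) \<in> borel_measurable N"
    if [measurable]: "h \<in> N \<rightarrow>\<^sub>M M" for h
    by (rule meas) measurable
  have "d (f \<omega>) (g \<omega>) = measure \<nu> {z\<in>space \<nu>. between (f \<omega>) z (g \<omega>)}
      - measure \<nu> {z\<in>space \<nu>. z = f \<omega>} / 2 - measure \<nu> {z\<in>space \<nu>. z = g \<omega>} / 2"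
    if "\<omega> \<in> space N" for \<omega>
  proof -
    have "{z\<in>space \<nu>. between (f \<omega>) z (g \<omega>)} = tree_interval T c (f \<omega>) (g \<omega>)"
      "{z\<in>space \<nu>. z = f \<omega>} = {f \<omega>}" "{z\<in>space \<nu>. z = g \<omega>} = {g \<omega>}"
      using T[OF that] by (auto simp: mem_interval)
    then show ?thesis by (simp add: d_eq)
  qed
  then show ?thesis
    using 1 2[OF assms(1)] 2[OF assms(2)] by (simp cong: measurable_cong)
qed

end

section \<open>Mass estimates for binary trees without inner atoms\<close>

text \<open>The relation and its converse cover W * W, and by Fubini each contributes at most K *
  \<open>prob W\<close>; dividing by \<open>prob W\<close> gives the claim. Bounds on the initial
  segments of a linear order thus bound the whole set without the choice of an extremal
  point.\<close>

lemma (in prob_space) prob_le_of_total_relation: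
  assumes W [measurable]: "W \<in> events"
    and R [measurable]: "Measurable.pred (M \<Otimes>\<^sub>M M) (\<lambda>(x, y). R x y)"
    and total: "\<And>x y. x \<in> W \<Longrightarrow> y \<in> W \<Longrightarrow> R x y \<or> R y x"
    and le: "\<And>y. y \<in> W \<Longrightarrow> prob {x\<in>W. R x y} \<le> K"
    and K: "0 \<le> K"
  shows "prob W \<le> 2 * K"
proof -
  interpret MM: pair_prob_space M M ..
  let ?Q = "{p\<in>space (M \<Otimes>\<^sub>M M). fst p \<in> W \<and> snd p \<in> W \<and> (\<lambda>(x, y). R x y) p}"
  let ?Q' = "{p\<in>space (M \<Otimes>\<^sub>M M). fst p \<in> W \<and> snd p \<in> W \<and> (\<lambda>(x, y). R x y) (snd p, fst p)}"
  have WM: "W \<subseteq> space M" using W sets.sets_into_space by blast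
  have [measurable]: "?Q \<in> sets (M \<Otimes>\<^sub>M M)" "?Q' \<in> sets (M \<Otimes>\<^sub>M M)" by measurable
  have bound: "emeasure M {x\<in>W. R x y} \<le> ennreal K" if "y \<in> W" for y
    using le[OF that] by (simp add: emeasure_eq_measure ennreal_leI)
  have "emeasure (M \<Otimes>\<^sub>M M) ?Q = (\<integral>\<^sup>+y. emeasure M ((\<lambda>x. (x, y)) -` ?Q) \<partial>M)"
    by (rule MM.emeasure_pair_measure_alt2) measurable
  also have "\<dots> \<le> (\<integral>\<^sup>+y. ennreal K * indicator W y \<partial>M)"
  proof (rule nn_integral_mono)
    fix y assume "y \<in> space M"
    have "(\<lambda>x. (x, y)) -` ?Q = (if y \<in> W then {x\<in>W. R x y} else {})"
      using WM by (auto simp: space_pair_measure)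
    then show "emeasure M ((\<lambda>x. (x, y)) -` ?Q) \<le> ennreal K * indicator W y"
      using bound by (simp split: split_indicator)
  qed
  also have "\<dots> = ennreal K * emeasure M W" by (simp add: nn_integral_cmult_indicator)
  finally have 1: "emeasure (M \<Otimes>\<^sub>M M) ?Q \<le> ennreal K * emeasure M W" .
  have "emeasure (M \<Otimes>\<^sub>M M) ?Q' = (\<integral>\<^sup>+x. emeasure M (Pair x -` ?Q') \<partial>M)"
    by (rule emeasure_pair_measure_alt) measurable
  also have "\<dots> \<le> (\<integral>\<^sup>+x. ennreal K * indicator W x \<partial>M)"
  proof (rule nn_integral_mono)
    fix x assume "x \<in> space M"
    have "Pair x -` ?Q' = (if x \<in> W then {y\<in>W. R y x} else {})"
      using WM by (auto simp: space_pair_measure)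
    then show "emeasure M (Pair x -` ?Q') \<le> ennreal K * indicator W x"
      using bound by (simp split: split_indicator)
  qed
  also have "\<dots> = ennreal K * emeasure M W" by (simp add: nn_integral_cmult_indicator)
  finally have 2: "emeasure (M \<Otimes>\<^sub>M M) ?Q' \<le> ennreal K * emeasure M W" .
  have "emeasure M W * emeasure M W = emeasure (M \<Otimes>\<^sub>M M) (W \<times> W)"
    by (simp add: emeasure_pair_measure_Times)
  also have "\<dots> \<le> emeasure (M \<Otimes>\<^sub>M M) (?Q \<union> ?Q')"
  proof (rule emeasure_mono)
    show "W \<times> W \<subseteq> ?Q \<union> ?Q'"
    proof
      fix p assume "p \<in> W \<times> W"
      then show "p \<in> ?Q \<union> ?Q'"
        using total[of "fst p" "snd p"] WM by (auto simp: space_pair_measure)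
    qed
  qed measurable
  also have "\<dots> \<le> emeasure (M \<Otimes>\<^sub>M M) ?Q + emeasure (M \<Otimes>\<^sub>M M) ?Q'"
    by (rule emeasure_subadditive) measurable
  also have "\<dots> \<le> ennreal K * emeasure M W + ennreal K * emeasure M W"
    by (rule add_mono[OF 1 2])
  finally have "prob W * prob W \<le> (2 * K) * prob W"
    using K by (simp add: emeasure_eq_measure ennreal_mult[symmetric] ennreal_plus[symmetric]
        del: ennreal_plus)
  then show ?thesis
    using K by (cases "prob W = 0") (auto simp: mult_le_cancel_right)
qed

section \<open>Stars and the degree of a point\<close>

context algebraic_tree
begin

text \<open>The points of X lie in pairwise distinct components at v, so the degree can be counted
  by points instead of by sets.\<close>

definition star :: "'a \<Rightarrow> 'a set \<Rightarrow> bool" where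
  "star v X \<longleftrightarrow> X \<subseteq> T - {v} \<and> pairwise (\<lambda>x y. between x v y) X"

lemma binary_tree_iff: "binary_tree T c \<longleftrightarrow> (\<forall>v\<in>T. \<forall>X. star v X \<longrightarrow> card X \<le> 3)"
proof -
  have "tree_degree T c v \<le> 3 \<longleftrightarrow> (\<forall>X. star v X \<longrightarrow> card X \<le> 3)" if v: "v \<in> T" for v
  proof -
    let ?C = "tree_component T c v"
    let ?I = "?C ` (T - {v})"
    have inj: "inj_on ?C X" if "star v X" for X
      using that v unfolding star_def pairwise_def inj_on_def by (metis DiffE component_eq_iff insertI1 subsetD)
    have star: "star v X" if "X \<subseteq> T - {v}" "inj_on ?C X" for X
      using that v unfolding star_def pairwise_def inj_on_def by (metis DiffE component_eq_iff insertI1 subsetD)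
    have deg: "tree_degree T c v \<le> 3 \<longleftrightarrow> finite ?I \<and> card ?I \<le> 3"
      by (simp add: tree_degree_def Let_def enat_ord_simps numeral_eq_enat)
    show ?thesis
    proof
      assume "tree_degree T c v \<le> 3"
      then have I: "finite ?I" "card ?I \<le> 3" using deg by auto
      show "\<forall>X. star v X \<longrightarrow> card X \<le> 3"
      proof (intro allI impI)
        fix X assume X: "star v X"
        then have "?C ` X \<subseteq> ?I" by (auto simp: star_def)
        then have "card (?C ` X) \<le> 3" using card_mono[OF I(1)] I(2) by (meson le_trans)
        then show "card X \<le> 3" by (simp add: card_image inj[OF X])
      qed
    next
      assume *: "\<forall>X. star v X \<longrightarrow> card X \<le> 3"
      obtain X where X: "X \<subseteq> T - {v}" "inj_on ?C X" "?C ` X = ?I"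
        using subset_image_inj[of ?I ?C "T - {v}"] by auto
      \<comment> \<open>Since \<open>card\<close> of an infinite set is 0, the bound on stars says
        nothing about X until a four point subset shows that X is finite.\<close>
      have "finite X"
      proof (rule ccontr)
        assume "infinite X"
        then obtain Y where Y: "finite Y" "card Y = 4" "Y \<subseteq> X"
          by (meson infinite_arbitrarily_large)
        then have "star v Y" using X by (intro star) (auto intro: inj_on_subset)
        then show False using * Y(2) by fastforce
      qed
      moreover have "card X \<le> 3" using * star X by blast
      ultimately show "tree_degree T c v \<le> 3"
        unfolding deg X(3)[symmetric] using card_image_le[of X ?C] by simp
    qed
  qed
  then show ?thesis unfolding binary_tree_def by blast
qed

lemma between_inner:
  assumes "x \<in> T" "w \<in> T" "m \<in> T" "v \<in> T" "between x w v" "between w m v"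
  shows "between x w m"
proof (cases "m = w")
  case False
  then show ?thesis
    using assms between_cases[of x m v w] between_antisym[of v w m] between_commute[of m w v]
      between_commute[of w m v] by blast
qed (use assms in simp)

lemma between_outer:
  assumes "x \<in> T" "w \<in> T" "v \<in> T" "y \<in> T" "between x v y" "between x w v"
  shows "between w v y"
proof (cases "w = v")
  case False
  then show ?thesis
    using assms between_cases[of x w y v] between_antisym[of x v w] by blast
qed (use assms in simp)

lemma between_component:
  assumes "v \<in> T" "x \<in> T" "y \<in> T" "x' \<in> tree_component T c v x" "between x v y"
  shows "between x' v y"
proof -
  have "x' \<in> T" "\<not> between x v x'"
    using assms by (simp_all add: mem_component)
  then show ?thesis using assms between_cases[of x x' y v] by blast
qed

end

section \<open>Branch point masses from component masses\<close>

context measure_tree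
begin

text \<open>The Gromov product: the three sides of the tripod are additive at the branch point, and
  one solves for the arm of x.\<close>

lemma d_median:
  assumes [simp]: "x \<in> T" "y \<in> T" "z \<in> T"
  shows "d x (c x y z) = (d x y + d x z - d y z) / 2"
proof -
  let ?m = "c x y z"
  have m: "?m \<in> T" by (simp add: closed)
  have "d x y = d x ?m + d ?m y" "d y z = d y ?m + d ?m z" "d x z = d x ?m + d ?m z"
    using d_additive[OF _ _ m median_between(1)[OF assms]]
      d_additive[OF _ _ m median_between(2)[OF assms]]
      d_additive[OF _ _ m median_between(3)[OF assms]] by simp_all
  then show ?thesis using d_commute[of y ?m] m by simp
qed

text \<open>Samples from three distinct components at v have v as their branch point.\<close>

lemma branch_point_mass:
  assumes [simp]: "v \<in> T" "x \<in> T" "y \<in> T" "z \<in> T" and "x \<noteq> v" "y \<noteq> v" "z \<noteq> v"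
    and b: "between x v y" "between y v z" "between x v z"
  shows "measure M (tree_component T c v x) * measure M (tree_component T c v y) *
    measure M (tree_component T c v z) \<le> measure \<nu> {v}"
proof (rule \<nu>_lower)
  fix x' y' z'
  assume C: "x' \<in> tree_component T c v x" "y' \<in> tree_component T c v y"
    "z' \<in> tree_component T c v z"
  then have [simp]: "x' \<in> T" "y' \<in> T" "z' \<in> T" using component_subset by blast+
  have *: "between a' v b'" if "a \<in> T" "b \<in> T" "between a v b" "a' \<in> tree_component T c v a"
    "b' \<in> tree_component T c v b" "a' \<in> T" "b' \<in> T" for a b a' b'
    using that between_component[of v a b a'] between_component[of v b a' b']
      between_commute[of a' v b] between_commute[of b' v a'] by simp
  show "c x' y' z' \<in> {v}"
    using *[OF _ _ b(1) C(1,2)] *[OF _ _ b(2) C(2,3)] *[OF _ _ b(3) C(1,3)] by (simp add: median_eqI)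
qed (use assms in simp_all)

text \<open>Replacing x by a point x' beyond w and y by a point y' beyond v keeps the projection of
  u, as it lies between w and v. The branch point of x', y', u is therefore on [w,v].\<close>

lemma projection_mass:
  assumes [simp]: "x \<in> T" "y \<in> T" "v \<in> T" "w \<in> T" and "w \<noteq> x" "v \<noteq> y"
    and b: "between x v y" "between x w v"
  shows "measure M (tree_component T c w x) * measure M (tree_component T c v y) *
    measure M {u\<in>T. between w (c x y u) v} \<le> measure \<nu> (tree_interval T c w v)"
proof (rule \<nu>_lower)
  have [measurable]: "x \<in> space M" "y \<in> space M" "v \<in> space M" "w \<in> space M" using space_M by auto
  have "{u\<in>space M. between w (c x y u) v} \<in> sets M" by measurable
  then show "{u\<in>T. between w (c x y u) v} \<in> sets M" by (simp add: space_M)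
  fix x' y' u
  assume C: "x' \<in> tree_component T c w x" "y' \<in> tree_component T c v y"
    "u \<in> {u\<in>T. between w (c x y u) v}"
  then have [simp]: "x' \<in> T" "y' \<in> T" "u \<in> T" using component_subset by blast+
  define m where "m = c x y u"
  have [simp]: "m \<in> T" by (simp add: m_def closed)
  have m: "between x m y" "between y m u" "between x m u"
    unfolding m_def by (rule median_between; simp)+
  have wmv: "between w m v" using C(3) by (simp add: m_def)
  have "between x w m" using between_inner[of x w m v] b wmv by simp
  \<comment> \<open>The point w does not separate x from x', and m is w or lies behind w as seen
    from x.\<close>
  then have nx: "\<not> between x m x'"
    using between_trans_left[of x x' m w] C(1) by (auto simp: mem_component)
  have "between w v y" using between_outer[of x w v y] b by simp
  then have "between y v m"
    using between_inner[of y v m w] wmv between_commute[of w v y] between_commute[of w m v] by simp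
  then have ny: "\<not> between y m y'"
    using between_trans_left[of y y' m v] C(2) by (auto simp: mem_component)
  have 1: "between x' m u" using between_cases[of x x' u m] nx m(3) by simp
  have 2: "between y' m u" using between_cases[of y y' u m] ny m(2) by simp
  have "between x' m y" using between_cases[of x x' y m] nx m(1) by simp
  then have 3: "between x' m y'"
    using between_cases[of x' y' y m] ny between_commute[of y' m y] by simp
  have "c x' y' u = m" using 1 2 3 by (simp add: median_eqI)
  then show "c x' y' u \<in> tree_interval T c w v" using wmv by (simp add: mem_interval)
qed (use assms in simp_all)

end

section \<open>Upper bounds from binarity and the absence of inner atoms\<close>

locale binary_measure_tree = measure_tree +
  assumes binary: "binary_tree T c"
    and atoms: "{x \<in> T. measure M {x} > 0} \<subseteq> leaves T c"
begin

lemma star_card: "v \<in> T \<Longrightarrow> star v X \<Longrightarrow> card X \<le> 3"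
  using binary unfolding binary_tree_iff by blast

text \<open>Otherwise x, y, z, u would form a star of four points: x and y occupy two of the three
  components at v, which leaves one for z and u.\<close>

lemma same_component:
  assumes "v \<in> T" "x \<in> T - {v}" "y \<in> T - {v}" "z \<in> T - {v}" "u \<in> T - {v}"
    and "between x v y" "between x v z" "between y v z" "between x v u" "between y v u"
  shows "\<not> between z v u"
proof
  assume zu: "between z v u"
  have "star v {x, y, z, u}"
    using assms zu between_commute[of _ v] by (auto simp: star_def pairwise_def)
  moreover have "card {x, y, z, u} = 4"
  proof -
    have "a \<noteq> b" if "a \<in> T - {v}" "between a v b" for a b
      using that between_same[of a v] assms(1) by auto
    then have "x \<noteq> y" "x \<noteq> z" "y \<noteq> z" "x \<noteq> u" "y \<noteq> u" "z \<noteq> u"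
      using assms zu by metis+
    then show ?thesis by simp
  qed
  ultimately show False using star_card[OF assms(1)] by fastforce
qed

lemma no_inner_atom:
  assumes "v \<in> T" "x \<in> T" "y \<in> T" "x \<noteq> v" "y \<noteq> v" "between x v y"
  shows "measure M {v} = 0"
proof (rule ccontr)
  assume "measure M {v} \<noteq> 0"
  then have "v \<in> leaves T c"
    using atoms assms(1) measure_nonneg[of M "{v}"] by (auto simp: less_le)
  moreover have "c v x y = v" using assms c_rotate[of v x y] by (simp add: between_def)
  ultimately show False using assms by (auto simp: leaves_def)
qed

text \<open>Three samples that avoid v and the component S of x lie in at most two components at v.
  Their branch point is then neither v nor in S, so it misses [x,v]. The union bound thus applies to
  S with v added, and the inner point v has mass zero.\<close>

lemma arm_mass:
  assumes [simp]: "v \<in> T" "x \<in> T" "y \<in> T" and ne [simp]: "x \<noteq> v" "y \<noteq> v"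
    and b: "between x v y"
  shows "d x v \<le> 3 * measure M (tree_component T c v x)"
proof -
  let ?S = "tree_component T c v x"
  have [measurable]: "?S \<in> sets M" "{v} \<in> sets M" using ne(1)[symmetric] by simp_all
  have "measure \<nu> (tree_interval T c x v) \<le> 3 * measure M (?S \<union> {v})"
  proof (rule \<nu>_upper)
    fix u1 u2 u3
    assume u: "u1 \<in> T - (?S \<union> {v})" "u2 \<in> T - (?S \<union> {v})" "u3 \<in> T - (?S \<union> {v})"
    define m where "m = c u1 u2 u3"
    have [simp]: "m \<in> T" using u by (simp add: m_def closed)
    have u_bet: "between x v u1" "between x v u2" "between x v u3"
      using u by (auto simp: mem_component)
    have "m \<notin> ?S" using u by (simp add: m_def median_in_component_iff)
    have "m \<noteq> v"
    proof
      assume "m = v"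
      then have "between u1 v u2" "between u2 v u3" "between u1 v u3"
        using median_between[of u1 u2 u3] u by (auto simp: m_def)
      then show False
        using same_component[of v x u1 u2 u3] u u_bet by simp
    qed
    then have "between x v m" using \<open>m \<notin> ?S\<close> by (simp add: mem_component)
    then have "\<not> between x m v"
      using between_antisym[of x v m] \<open>m \<noteq> v\<close> by auto
    then show "c u1 u2 u3 \<notin> tree_interval T c x v" by (simp add: mem_interval m_def)
  next
    show "?S \<union> {v} \<in> sets M" by (intro sets.Un) simp_all
  qed simp
  also have "measure M (?S \<union> {v}) \<le> measure M ?S + measure M {v}"
    by (rule measure_Un_le) simp_all
  finally show ?thesis
    using d_le_\<nu>[of x v] no_inner_atom[of v x y] b by simp
qed

text \<open>For a projection w, the masses beyond w and beyond v are at least k / 3 by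
  \<open>arm_mass\<close>, and \<nu>[w,v] is at most 2 * e, so \<open>projection_mass\<close> allows
  mass at most 18 * e / k^2 to project between w and v. The projections are linearly ordered, so
  \<open>prob_le_of_total_relation\<close> bounds the whole set by twice this.\<close>

lemma spine_mass:
  assumes [simp]: "x \<in> T" "y \<in> T" "v \<in> T" and b: "between x v y"
    and k: "0 < k" "k < d y v" and e: "0 < e"
  shows "measure M {u\<in>T. c x y u \<noteq> v \<and> between x (c x y u) v \<and> k < d x (c x y u) \<and>
    d (c x y u) v < e} \<le> 36 * e / k\<^sup>2"
proof -
  let ?W = "{u\<in>T. c x y u \<noteq> v \<and> between x (c x y u) v \<and> k < d x (c x y u) \<and> d (c x y u) v < e}"
  have [measurable]: "x \<in> space M" "y \<in> space M" "v \<in> space M" using space_M by auto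
  have vy: "v \<noteq> y" using k d_same[of y] by auto
  have "{u\<in>space M. c x y u \<noteq> v \<and> between x (c x y u) v \<and> k < d x (c x y u) \<and>
    d (c x y u) v < e} \<in> sets M" by measurable
  then have W: "?W \<in> sets M" unfolding space_M .
  have "measure M ?W \<le> 2 * (18 * e / k\<^sup>2)"
  proof (rule prob_le_of_total_relation[OF W])
    \<comment> \<open>The relation says that u projects at least as close to v as u' does.\<close>
    show "Measurable.pred (M \<Otimes>\<^sub>M M) (\<lambda>(u, u'). between (c x y u') (c x y u) v)"
      by measurable
  next
    fix u u' assume u: "u \<in> ?W" "u' \<in> ?W"
    then show "between (c x y u') (c x y u) v \<or> between (c x y u) (c x y u') v"
      using between_cases[of x "c x y u'" v "c x y u"] between_outer[of x "c x y u" "c x y u'" v]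
        closed[of x y] by auto
  next
    fix u' assume u': "u' \<in> ?W"
    define w where "w = c x y u'"
    have [simp]: "w \<in> T" and w: "w \<noteq> v" "between x w v" "k < d x w" "d w v < e"
      using u' closed by (auto simp: w_def)
    have wx: "w \<noteq> x" using w(3) k d_same[of x] by auto
    have wy: "between x w y" using b w(2) between_trans_left[of x y v w] by simp
    then have "w \<noteq> y" using between_antisym[of x v y] between_trans_left[of x v w y] w b vy by auto
    let ?m = "measure M {u\<in>T. between w (c x y u) v}"
    let ?a = "measure M (tree_component T c w x)" and ?b = "measure M (tree_component T c v y)"
    have [measurable]: "w \<in> space M" by (simp add: space_M)
    have "{u\<in>space M. between w (c x y u) v} \<in> sets M" by measurable
    then have "measure M {u \<in> ?W. between (c x y u') (c x y u) v} \<le> ?m"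
      by (intro finite_measure_mono) (auto simp: w_def space_M)
    also have "?m \<le> 18 * e / k\<^sup>2"
    proof -
      have "d x w \<le> 3 * ?a"
        using wx \<open>w \<noteq> y\<close> wy by (intro arm_mass[of w x y]) auto
      then have a: "k / 3 \<le> ?a" using w(3) by simp
      have "v \<noteq> x" using w between_same[of x w] by auto
      then have "d y v \<le> 3 * ?b"
        using vy b between_commute[of x v y] by (intro arm_mass[of v y x]) auto
      then have b': "k / 3 \<le> ?b" using k by simp
      have "(k / 3) * (k / 3) * ?m \<le> ?a * ?b * ?m"
        using a b' k by (intro mult_right_mono mult_mono) auto
      also have "\<dots> \<le> measure \<nu> (tree_interval T c w v)"
        using wx vy b w by (intro projection_mass) auto
      also have "\<dots> \<le> 2 * e"
        using \<nu>_interval_le[of w v] w by simp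
      finally show ?thesis using k by (simp add: field_simps power2_eq_square)
    qed
    finally show "measure M {u \<in> ?W. between (c x y u') (c x y u) v} \<le> 18 * e / k\<^sup>2" .
  qed (use e in simp)
  then show ?thesis by simp
qed

text \<open>By binarity all such u lie in the one component S at v that x and y leave over. The mass
  of S times k^2 / 9 is at most \<nu>{v}, and any single u of the set shows that \<nu>{v} is at most
  2 * e / k.\<close>

lemma bush_mass:
  assumes [simp]: "x \<in> T" "y \<in> T" "z \<in> T" and v: "v = c x y z"
    and k: "0 < k" "k \<le> 1" "k < d x v" "k < d y v" and e: "0 < e"
  shows "measure M {u\<in>T. u \<noteq> v \<and> c x y u = v \<and> d z v + d u v - d z u < e \<and> k * d u v - d z v < e}
    \<le> 18 * e / k ^ 3"
proof (cases "{u\<in>T. u \<noteq> v \<and> c x y u = v \<and> d z v + d u v - d z u < e \<and> k * d u v - d z v < e} = {}")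
  case True
  then show ?thesis using k e by (simp only: measure_empty) simp
next
  case False
  let ?W = "{u\<in>T. u \<noteq> v \<and> c x y u = v \<and> d z v + d u v - d z u < e \<and> k * d u v - d z v < e}"
  obtain u where u [simp]: "u \<in> T" and u': "u \<noteq> v" "c x y u = v" "d z v + d u v - d z u < e"
    "k * d u v - d z v < e"
    using False by blast
  have [simp]: "v \<in> T" by (simp add: v closed)
  have xv: "x \<noteq> v" "y \<noteq> v" using k d_same[of v] by auto
  have b: "between x v y" "between y v u" "between x v u" "between y v z" "between x v z"
    using median_between[of x y u] median_between[of x y z] by (simp_all add: u'(2) v[symmetric])
  let ?S = "tree_component T c v u"
  have "measure \<nu> {v} \<le> 2 * e / k"
  proof (cases "z = v")
    \<comment> \<open>For z = v the overlap condition carries no information; the last condition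
      makes the arm of u short instead.\<close>
    case True
    then have "k * d u v < e" using u'(4) d_same[of v] by simp
    moreover have "measure \<nu> {v} \<le> 2 * d u v" using u' by (intro \<nu>_singleton_le) auto
    then have "k * measure \<nu> {v} \<le> 2 * (k * d u v)"
      using mult_left_mono[of "measure \<nu> {v}" "2 * d u v" k] k by (simp only: mult.left_commute)
    ultimately have "k * measure \<nu> {v} \<le> 2 * e" using e by linarith
    then show ?thesis using k by (simp add: field_simps)
  next
    case zv: False
    \<comment> \<open>The paths from z and u to v merge at t, before they reach v. Twice the length
      of the shared piece [v,t] is the overlap term, which is less than e.\<close>
    define t where "t = c v z u"
    have [simp]: "t \<in> T" by (simp add: t_def closed)
    have "\<not> between z v u"
      using same_component[of v x y z u] b u' xv zv by simp
    then have "t \<noteq> v"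
      using median_between(2)[of v z u] by (auto simp: t_def)
    then have "measure \<nu> {v} \<le> 2 * d v t" by (intro \<nu>_singleton_le) auto
    moreover have "d v t = (d v z + d v u - d z u) / 2" unfolding t_def by (rule d_median) simp_all
    ultimately have "measure \<nu> {v} \<le> e"
      using u'(3) d_commute[of v z] d_commute[of v u] by simp
    also have "e \<le> 2 * e / k" using e k by (simp add: field_simps)
    finally show ?thesis .
  qed
  moreover have "measure M (tree_component T c v x) * measure M (tree_component T c v y) *
    measure M ?S \<le> measure \<nu> {v}"
    using b xv u' by (intro branch_point_mass) auto
  moreover have "(k / 3) * (k / 3) * measure M ?S \<le>
    measure M (tree_component T c v x) * measure M (tree_component T c v y) * measure M ?S"
  proof (intro mult_right_mono mult_mono)
    show "k / 3 \<le> measure M (tree_component T c v x)"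
      using arm_mass[of v x y] xv b k by simp
    show "k / 3 \<le> measure M (tree_component T c v y)"
      using arm_mass[of v y x] xv b between_commute[of x v y] k by simp
  qed (use k in auto)
  ultimately have "(k / 3) * (k / 3) * measure M ?S \<le> 2 * e / k" by linarith
  then have "measure M ?S \<le> 18 * e / k ^ 3"
    using k by (simp add: field_simps power3_eq_cube)
  moreover have "measure M ?W \<le> measure M ?S"
  proof (rule finite_measure_mono)
    show "?W \<subseteq> ?S"
    proof
      fix w assume w: "w \<in> ?W"
      then have "between y v w" "between x v w"
        using median_between[of x y w] by auto
      then have "\<not> between u v w"
        using same_component[of v x y u w] w u' b xv by simp
      then show "w \<in> ?S" using w by (simp add: mem_component)
    qed
    show "?S \<in> sets M" using u'(1)[symmetric] by simp
  qed
  ultimately show ?thesis by linarith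
qed

text \<open>Let w be the projection of the fourth point u to [x,y]. If w = v, then u is the null
  point v or is covered by \<open>bush_mass\<close>; otherwise w is within e of v on one of two
  sides, each covered by \<open>spine_mass\<close>. As k \<le> 1, the sum 18 / k^3 + 72 / k^2 is at
  most 90 / k^3.\<close>

lemma near_star_mass:
  assumes [simp]: "x \<in> T" "y \<in> T" "z \<in> T" and v: "v = c x y z"
    and k: "0 < k" "k \<le> 1" and e: "0 < e"
  shows "measure M {u\<in>T. k < d x v \<and> k < d y v \<and> k < d x (c x y u) \<and> k < d y (c x y u) \<and>
    \<bar>d x v - d x (c x y u)\<bar> < e \<and> d z v + d u (c x y u) - d z u < e \<and>
    k * d u (c x y u) - d z v < e} \<le> 90 * e / k ^ 3" (is "measure M ?W \<le> _")
proof (cases "k < d x v \<and> k < d y v")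
  case False
  then have "?W = {}" by auto
  then show ?thesis using k e by (simp only: measure_empty) simp
next
  case True
  have [simp]: "v \<in> T" by (simp add: v closed)
  have [measurable]: "x \<in> space M" "y \<in> space M" "v \<in> space M" "z \<in> space M" using space_M by auto
  let ?A = "\<lambda>x y. {u\<in>T. c x y u \<noteq> v \<and> between x (c x y u) v \<and> k < d x (c x y u) \<and>
    d (c x y u) v < e}"
  let ?B = "{u\<in>T. u \<noteq> v \<and> c x y u = v \<and> d z v + d u v - d z u < e \<and> k * d u v - d z v < e}"
  have "{u\<in>space M. c x y u \<noteq> v \<and> between x (c x y u) v \<and> k < d x (c x y u) \<and>
    d (c x y u) v < e} \<in> sets M" if [measurable]: "x \<in> space M" "y \<in> space M" for x y
    by measurable
  then have [measurable]: "?A x y \<in> sets M" "?A y x \<in> sets M"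
    unfolding space_M by (rule; simp)+
  have "{u\<in>space M. u \<noteq> v \<and> c x y u = v \<and> d z v + d u v - d z u < e \<and> k * d u v - d z v < e} \<in> sets M"
    by measurable
  then have [measurable]: "?B \<in> sets M" unfolding space_M .
  have [measurable]: "{v} \<in> sets M" by simp
  have v_b: "between x v y" using median_between(1)[of x y z] by (simp add: v)
  have sub: "?W \<subseteq> {v} \<union> ?B \<union> (?A x y \<union> ?A y x)"
  proof
    fix u assume u: "u \<in> ?W"
    define w where "w = c x y u"
    have [simp]: "u \<in> T" using u by simp
    have [simp]: "w \<in> T" by (simp add: w_def closed)
    have w_b: "between x w y" using median_between(1)[of x y u] by (simp add: w_def)
    have yx: "c y x u = w" using sym12[of x y u] by (simp add: w_def)
    have u': "k < d x w" "k < d y w" "\<bar>d x v - d x w\<bar> < e" "d z v + d u w - d z u < e"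
      "k * d u w - d z v < e" using u by (auto simp: w_def)
    show "u \<in> {v} \<union> ?B \<union> (?A x y \<union> ?A y x)"
    proof (cases "w = v")
      case True
      then show ?thesis using u' by (auto simp: w_def)
    next
      case wv: False
      have "between x w v \<or> between v w y" using between_cases[of x v y w] w_b by simp
      then show ?thesis
      proof
        assume xw: "between x w v"
        have "d x v = d x w + d w v" using xw by (intro d_additive) simp_all
        then have "d w v < e" using u' by linarith
        then show ?thesis using u' wv xw by (simp add: w_def)
      next
        assume wy: "between v w y"
        have xv: "between x v w"
          using between_outer[of y w v x] between_commute[of x v y] between_commute[of v w y]
            between_commute[of w v x] w_b v_b wy between_commute[of x w y]
            between_inner[of x v w y] by simp
        have "d x w = d x v + d v w" using xv by (intro d_additive) simp_all
        then have "d w v < e" using u' d_commute[of v w] by simp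
        moreover have "between y w v" using wy between_commute[of v w y] by simp
        ultimately show ?thesis using u' wv by (simp add: yx)
      qed
    qed
  qed
  have "measure M ?W \<le> measure M ({v} \<union> ?B \<union> (?A x y \<union> ?A y x))"
    by (rule finite_measure_mono[OF sub]) (intro sets.Un; fact)
  also have "\<dots> \<le> measure M ({v} \<union> ?B) + measure M (?A x y \<union> ?A y x)"
    by (rule measure_Un_le) (intro sets.Un; fact)+
  also have "\<dots> \<le> (measure M {v} + measure M ?B) + (measure M (?A x y) + measure M (?A y x))"
    by (intro add_mono measure_Un_le; fact)
  also have "\<dots> \<le> (0 + 18 * e / k ^ 3) + (36 * e / k\<^sup>2 + 36 * e / k\<^sup>2)"
  proof (intro add_mono)
    have "x \<noteq> v" "y \<noteq> v" using True k d_same[of v] by auto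
    then show "measure M {v} \<le> 0"
      using no_inner_atom[of v x y] v_b by simp
    show "measure M ?B \<le> 18 * e / k ^ 3"
      using True k e v by (intro bush_mass) auto
    show "measure M (?A x y) \<le> 36 * e / k\<^sup>2"
      using True k e v_b by (intro spine_mass) auto
    show "measure M (?A y x) \<le> 36 * e / k\<^sup>2"
      using True k e v_b between_commute[of x v y] by (intro spine_mass) auto
  qed
  also have "\<dots> \<le> 90 * e / k ^ 3"
    using k e by (simp add: field_simps power2_eq_square power3_eq_cube)
  finally show ?thesis .
qed

end

section \<open>A polynomial detecting near stars\<close>

definition distance_matrix :: "nat \<Rightarrow> 'a tree_triple \<Rightarrow> (nat \<Rightarrow> 'a) \<Rightarrow> nat \<times> nat \<Rightarrow> real" where
  "distance_matrix m t x = (\<lambda>(i, j)\<in>{..<m} \<times> {..<m}. bpd_dist t (x i) (x j))"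

lemma amt_polynomial_eq:
  "amt_polynomial m \<phi> (T, c, M) = (\<integral>x. \<phi> (distance_matrix m (T, c, M) x) \<partial>(\<Pi>\<^sub>M i\<in>{..<m}. M))"
  by (simp add: amt_polynomial_def distance_matrix_def)

text \<open>For a tree metric \<open>r\<close> on \<open>x\<^sub>0, x\<^sub>1, x\<^sub>2, x\<^sub>3\<close>, the
  expressions \<open>p i\<close>, \<open>q i\<close>, \<open>s i\<close> are the distances of \<open>x\<^sub>0\<close>, \<open>x\<^sub>1\<close>, \<open>x\<^sub>i\<close> to the
  branch point of \<open>x\<^sub>0, x\<^sub>1, x\<^sub>i\<close>. The function is positive only if the four points are close to
  a star in which the arms of \<open>x\<^sub>0\<close> and \<open>x\<^sub>1\<close> are long, and the arm of \<open>x\<^sub>3\<close> may be long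
  only if that of \<open>x\<^sub>2\<close> is.\<close>

definition near_star :: "real \<Rightarrow> real \<Rightarrow> (nat \<times> nat \<Rightarrow> real) \<Rightarrow> real" where
  "near_star k e r = (let
     p = \<lambda>i. (r (0, 1) + r (0, i) - r (1, i)) / 2;
     q = \<lambda>i. (r (0, 1) + r (1, i) - r (0, i)) / 2;
     s = \<lambda>i. (r (0, i) + r (1, i) - r (0, 1)) / 2
   in max 0 (min (min (min (p 2 / k - 1) (p 3 / k - 1)) (min (q 2 / k - 1) (q 3 / k - 1)))
     (min (min (1 - \<bar>p 2 - p 3\<bar> / e) (1 - (s 2 + s 3 - r (2, 3)) / e))
       (min (1 - (k * s 3 - s 2) / e) 1))))"

lemma near_star_nonneg: "0 \<le> near_star k e r"
  unfolding near_star_def Let_def by (rule max.cobounded1)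

lemma near_star_le_1: "near_star k e r \<le> 1"
  unfolding near_star_def Let_def
  by (intro max.boundedI min.coboundedI2 order_refl zero_le_one)

lemma near_star_bounded_continuous:
  assumes "0 < k" "0 < e"
  shows "near_star k e \<in> bounded_continuous 4"
proof -
  have proj: "continuous_map (matrix_topology 4) euclideanreal (\<lambda>r. r (i, j))" if "i < 4" "j < 4" for i j
    unfolding matrix_topology_def by (rule continuous_map_product_projection) (use that in simp)
  have "continuous_map (matrix_topology 4) euclideanreal (near_star k e)"
    unfolding near_star_def Let_def
    by (intro continuous_map_real_max continuous_map_real_min continuous_map_diff continuous_map_add
        continuous_map_real_abs continuous_map_real_divide continuous_map_real_mult
        continuous_map_canonical_const proj) (use assms in auto)
  moreover have "bounded (near_star k e ` topspace (matrix_topology 4))"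
    by (rule boundedI[where B=1]) (auto simp: near_star_nonneg near_star_le_1)
  ultimately show ?thesis by (simp add: bounded_continuous_def)
qed

context measure_tree
begin

lemma measurable_distance_matrix:
  assumes \<phi>: "\<phi> \<in> bounded_continuous m"
    and f: "\<And>i. i < m \<Longrightarrow> (\<lambda>\<omega>. f \<omega> i) \<in> N \<rightarrow>\<^sub>M M"
  shows "(\<lambda>\<omega>. \<phi> (distance_matrix m (T, c, M) (f \<omega>))) \<in> borel_measurable N"
proof -
  let ?I = "{..<m} \<times> {..<m}"
  \<comment> \<open>Precomposition with the restriction extends \<phi> continuously to all functions
    on pairs, for which measurability can be checked coordinatewise.\<close>
  have "continuous_map euclidean (matrix_topology m) (\<lambda>g. restrict g ?I)"
    unfolding matrix_topology_def continuous_map_componentwise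
    by (auto simp: euclidean_product_topology[symmetric] intro!: continuous_map_product_projection)
  then have "continuous_map euclidean euclideanreal (\<phi> \<circ> (\<lambda>g. restrict g ?I))"
    using \<phi> unfolding bounded_continuous_def by (blast intro: continuous_map_compose)
  then have "continuous_on UNIV (\<lambda>g. \<phi> (restrict g ?I))"
    by (simp add: comp_def)
  then have [measurable]: "(\<lambda>g. \<phi> (restrict g ?I)) \<in> borel_measurable borel"
    by (rule borel_measurable_continuous_onI)
  \<comment> \<open>The value 0 outside the index square is a filler that the restriction
    overwrites.\<close>
  have "(\<lambda>\<omega>. if p \<in> ?I then d (f \<omega> (fst p)) (f \<omega> (snd p)) else 0) \<in> borel_measurable N" for p
    using f[of "fst p"] f[of "snd p"] by (cases "p \<in> ?I") auto
  then have "(\<lambda>\<omega> p. if p \<in> ?I then d (f \<omega> (fst p)) (f \<omega> (snd p)) else 0) \<in> borel_measurable N"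
    by (rule measurable_coordinatewise_then_product)
  then have "(\<lambda>\<omega>. \<phi> (restrict (\<lambda>p. if p \<in> ?I then d (f \<omega> (fst p)) (f \<omega> (snd p)) else 0) ?I))
    \<in> borel_measurable N"
    by measurable
  moreover have "restrict (\<lambda>p. if p \<in> ?I then d (f \<omega> (fst p)) (f \<omega> (snd p)) else 0) ?I =
      distance_matrix m (T, c, M) (f \<omega>)" for \<omega>
    by (auto simp: distance_matrix_def fun_eq_iff)
  ultimately show ?thesis by simp
qed

text \<open>By \<open>d_median\<close> the expressions p, q, s in \<open>near_star\<close> are
  distances to the two branch points v and w.\<close>

lemma near_star_matrix:
  assumes x: "x 0 \<in> T" "x 1 \<in> T" "x 2 \<in> T" "x 3 \<in> T"
  defines "v \<equiv> c (x 0) (x 1) (x 2)" and "w \<equiv> c (x 0) (x 1) (x 3)"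
  shows "near_star k e (distance_matrix 4 (T, c, M) x) =
    max 0 (min (min (min (d (x 0) v / k - 1) (d (x 0) w / k - 1))
        (min (d (x 1) v / k - 1) (d (x 1) w / k - 1)))
     (min (min (1 - \<bar>d (x 0) v - d (x 0) w\<bar> / e) (1 - (d (x 2) v + d (x 3) w - d (x 2) (x 3)) / e))
       (min (1 - (k * d (x 3) w - d (x 2) v) / e) 1)))"
proof -
  have "d a (c a b u) = (d a b + d a u - d b u) / 2" "d b (c a b u) = (d a b + d b u - d a u) / 2"
    "d u (c a b u) = (d a u + d b u - d a b) / 2" if "a \<in> T" "b \<in> T" "u \<in> T" for a b u
    using d_median[of a b u] d_median[of b a u] d_median[of u a b] that sym12[of a b u]
      c_rotate[of u a b] d_commute[of a b] d_commute[of u a] d_commute[of u b] by simp_all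
  note arms = this[symmetric]
  let ?R = "distance_matrix 4 (T, c, M) x"
  have entries: "?R (0, 1) = d (x 0) (x 1)" "?R (0, 2) = d (x 0) (x 2)" "?R (0, 3) = d (x 0) (x 3)"
    "?R (1, 2) = d (x 1) (x 2)" "?R (1, 3) = d (x 1) (x 3)" "?R (2, 3) = d (x 2) (x 3)"
    by (simp_all add: distance_matrix_def)
  show ?thesis
    unfolding near_star_def Let_def v_def w_def
    by (simp only: entries arms x)
qed

end

text \<open>The inner integral runs over the fourth point with the other three fixed. There the
  function is at most the indicator of the set in \<open>near_star_mass\<close>.\<close>

lemma (in binary_measure_tree) amt_polynomial_near_star_le:
  assumes k: "0 < k" "k \<le> 1" and e: "0 < e"
  shows "amt_polynomial 4 (near_star k e) (T, c, M) \<le> 90 * e / k ^ 3"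
proof -
  interpret P: product_prob_space "\<lambda>_::nat. M" UNIV ..
  let ?f = "\<lambda>x. ennreal (near_star k e (distance_matrix 4 (T, c, M) x))"
  have f: "?f \<in> borel_measurable (\<Pi>\<^sub>M i\<in>insert 3 {..<3}. M)"
    using near_star_bounded_continuous[OF k(1) e]
    by (intro measurable_compose[OF _ measurable_ennreal] measurable_distance_matrix
        measurable_component_singleton) auto
  have I: "{..<4} = insert 3 {..<3::nat}" by auto
  have "(\<integral>\<^sup>+x. ?f x \<partial>(\<Pi>\<^sub>M i\<in>{..<4}. M)) =
      (\<integral>\<^sup>+x. (\<integral>\<^sup>+u. ?f (x(3 := u)) \<partial>M) \<partial>(\<Pi>\<^sub>M i\<in>{..<3}. M))"
    unfolding I by (rule P.product_nn_integral_insert[OF _ _ f]) auto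
  also have "\<dots> \<le> (\<integral>\<^sup>+x. ennreal (90 * e / k ^ 3) \<partial>(\<Pi>\<^sub>M i\<in>{..<3::nat}. M))"
  proof (rule nn_integral_mono)
    fix x assume "x \<in> space (\<Pi>\<^sub>M i\<in>{..<3::nat}. M)"
    then have x [simp]: "x 0 \<in> T" "x (Suc 0) \<in> T" "x 2 \<in> T"
      by (auto simp: space_PiM space_M PiE_def Pi_def)
    define v where "v = c (x 0) (x 1) (x 2)"
    let ?W = "{u\<in>T. k < d (x 0) v \<and> k < d (x 1) v \<and> k < d (x 0) (c (x 0) (x 1) u) \<and>
      k < d (x 1) (c (x 0) (x 1) u) \<and> \<bar>d (x 0) v - d (x 0) (c (x 0) (x 1) u)\<bar> < e \<and>
      d (x 2) v + d u (c (x 0) (x 1) u) - d (x 2) u < e \<and>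
      k * d u (c (x 0) (x 1) u) - d (x 2) v < e}"
    have [measurable]: "x 0 \<in> space M" "x 1 \<in> space M" "x 2 \<in> space M" "v \<in> space M"
      using x closed by (auto simp: space_M v_def)
    have "{u\<in>space M. k < d (x 0) v \<and> k < d (x 1) v \<and> k < d (x 0) (c (x 0) (x 1) u) \<and>
      k < d (x 1) (c (x 0) (x 1) u) \<and> \<bar>d (x 0) v - d (x 0) (c (x 0) (x 1) u)\<bar> < e \<and>
      d (x 2) v + d u (c (x 0) (x 1) u) - d (x 2) u < e \<and>
      k * d u (c (x 0) (x 1) u) - d (x 2) v < e} \<in> sets M" by measurable
    then have W: "?W \<in> sets M" unfolding space_M .
    have "(\<integral>\<^sup>+u. ?f (x(3 := u)) \<partial>M) \<le> (\<integral>\<^sup>+u. indicator ?W u \<partial>M)"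
    proof (rule nn_integral_mono)
      fix u assume "u \<in> space M"
      then have [simp]: "u \<in> T" by (simp add: space_M)
      show "?f (x(3 := u)) \<le> indicator ?W u"
      proof (cases "u \<in> ?W")
        case True
        then show ?thesis using near_star_le_1 by simp
      next
        case False
        have "\<not> 0 < near_star k e (distance_matrix 4 (T, c, M) (x(3 := u)))"
        proof
          define w where "w = c (x 0) (x 1) u"
          assume "0 < near_star k e (distance_matrix 4 (T, c, M) (x(3 := u)))"
          moreover have "near_star k e (distance_matrix 4 (T, c, M) (x(3 := u))) =
            max 0 (min (min (min (d (x 0) v / k - 1) (d (x 0) w / k - 1))
                (min (d (x 1) v / k - 1) (d (x 1) w / k - 1)))
              (min (min (1 - \<bar>d (x 0) v - d (x 0) w\<bar> / e)
                  (1 - (d (x 2) v + d u w - d (x 2) u) / e))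
                (min (1 - (k * d u w - d (x 2) v) / e) 1)))"
          proof -
            have y: "(x(3 := u)) 0 = x 0" "(x(3 := u)) 1 = x 1" "(x(3 := u)) 2 = x 2"
              "(x(3 := u)) 3 = u" by simp_all
            show ?thesis
              unfolding v_def w_def
              by (rule near_star_matrix[of "x(3 := u)" k e, unfolded y])
                (use \<open>u \<in> T\<close> x in simp_all)
          qed
          ultimately have "0 < d (x 0) v / k - 1" "0 < d (x 0) w / k - 1"
            "0 < d (x 1) v / k - 1" "0 < d (x 1) w / k - 1"
            "0 < 1 - \<bar>d (x 0) v - d (x 0) w\<bar> / e"
            "0 < 1 - (d (x 2) v + d u w - d (x 2) u) / e"
            "0 < 1 - (k * d u w - d (x 2) v) / e"
            by (simp_all only: less_max_iff_disj min_less_iff_conj less_irrefl simp_thms)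
          then have "u \<in> ?W"
            using k e unfolding w_def by (simp add: pos_less_divide_eq pos_divide_less_eq)
          then show False using False by blast
        qed
        then show ?thesis using near_star_nonneg[of k e] by (simp add: ennreal_neg not_less)
      qed
    qed
    also have "\<dots> = ennreal (measure M ?W)"
      by (simp only: nn_integral_indicator[OF W] emeasure_eq_measure)
    also have "\<dots> \<le> ennreal (90 * e / k ^ 3)"
    proof (rule ennreal_leI, rule near_star_mass)
      show "x 0 \<in> T" "x 1 \<in> T" "x 2 \<in> T" by simp_all
    qed (fact v_def k e)+
    finally show "(\<integral>\<^sup>+u. ?f (x(3 := u)) \<partial>M) \<le> ennreal (90 * e / k ^ 3)" .
  qed
  also have "\<dots> = ennreal (90 * e / k ^ 3)"
    using prob_space.emeasure_space_1[OF prob_space_PiM[of "{..<3::nat}" "\<lambda>_. M"]] prob_space_axioms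
    by simp
  finally show ?thesis
    unfolding amt_polynomial_eq using k e by (intro integral_real_bounded) auto
qed

context measure_tree
begin

text \<open>In an exact star both branch points are v, so no error term lowers the value, and the
  factor in 2 * k lifts the length terms to 1. This holds for every e.\<close>

lemma near_star_eq_1:
  assumes [simp]: "x 0 \<in> T" "x 1 \<in> T" "x 2 \<in> T" "x 3 \<in> T" "v \<in> T"
    and b: "\<And>i j. i < j \<Longrightarrow> j < 4 \<Longrightarrow> between (x i) v (x j)"
    and k: "0 < k" "2 * k \<le> d (x 0) v" "2 * k \<le> d (x 1) v" "k * d (x 3) v \<le> d (x 2) v"
    and e: "0 < e"
  shows "near_star k e (distance_matrix 4 (T, c, M) x) = 1"
proof -
  have [simp]: "x (Suc 0) \<in> T" using assms(2) by simp
  have "c (x 0) (x 1) (x 2) = v" "c (x 0) (x 1) (x 3) = v"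
    using b[of 0 1] b[of 0 2] b[of 0 3] b[of 1 2] b[of 1 3] by (simp_all add: median_eqI)
  moreover have "d (x 2) (x 3) = d (x 2) v + d (x 3) v"
    using d_additive[of "x 2" "x 3" v] b[of 2 3] d_commute[of v "x 3"] by simp
  ultimately have "near_star k e (distance_matrix 4 (T, c, M) x) =
    max 0 (min (min (min (d (x 0) v / k - 1) (d (x 0) v / k - 1))
        (min (d (x 1) v / k - 1) (d (x 1) v / k - 1)))
      (min (min (1 - 0 / e) (1 - 0 / e)) (min (1 - (k * d (x 3) v - d (x 2) v) / e) 1)))"
    using near_star_matrix[of x k e] by (simp only: assms) simp
  moreover have "1 \<le> d (x 0) v / k - 1" "1 \<le> d (x 1) v / k - 1"
    "1 \<le> 1 - (k * d (x 3) v - d (x 2) v) / e"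
    using k e by (simp_all add: pos_le_divide_eq divide_nonpos_pos)
  ultimately have "1 \<le> near_star k e (distance_matrix 4 (T, c, M) x)"
    by (simp add: le_max_iff_disj)
  then show ?thesis using near_star_le_1 by (rule antisym[rotated])
qed

text \<open>The function is 1 on the product of the sets \<open>B i\<close>. The bound is uniform in
  e, whereas the bound for binary trees tends to 0 with e.\<close>

lemma amt_polynomial_near_star_ge:
  fixes B :: "nat \<Rightarrow> 'a set"
  assumes [measurable]: "\<And>i. i < 4 \<Longrightarrow> B i \<in> sets M"
    and "v \<in> T" and b: "\<And>i j x y. i < j \<Longrightarrow> j < 4 \<Longrightarrow> x \<in> B i \<Longrightarrow> y \<in> B j \<Longrightarrow> between x v y"
    and k: "0 < k" "\<And>x. x \<in> B 0 \<union> B 1 \<Longrightarrow> 2 * k \<le> d x v"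
      "\<And>x y. x \<in> B 2 \<Longrightarrow> y \<in> B 3 \<Longrightarrow> k * d y v \<le> d x v"
    and e: "0 < e"
  shows "(\<Prod>i<4. measure M (B i)) \<le> amt_polynomial 4 (near_star k e) (T, c, M)"
proof -
  interpret P: finite_product_prob_space "\<lambda>_::nat. M" "{..<4}" by standard simp
  let ?P = "\<Pi>\<^sub>M i\<in>{..<4::nat}. M"
  let ?f = "\<lambda>x. near_star k e (distance_matrix 4 (T, c, M) x)"
  have f [measurable]: "?f \<in> borel_measurable ?P"
    using near_star_bounded_continuous[OF k(1) e] by (rule measurable_distance_matrix) auto
  have B [measurable]: "Pi\<^sub>E {..<4} B \<in> sets ?P" by (intro sets_PiM_I_finite) auto
  have "(\<Prod>i<4. measure M (B i)) = measure ?P (Pi\<^sub>E {..<4} B)"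
    by (rule P.prob_times[symmetric]) auto
  also have "\<dots> = (\<integral>x. indicator (Pi\<^sub>E {..<4} B) x \<partial>?P)"
    by (simp add: sets.Int_space_eq2)
  also have "\<dots> \<le> (\<integral>x. ?f x \<partial>?P)"
  proof (rule integral_mono)
    show "integrable ?P (indicator (Pi\<^sub>E {..<4} B) :: _ \<Rightarrow> real)" by (simp add: P.emeasure_eq_measure)
    show "integrable ?P ?f"
      by (rule P.integrable_const_bound[of _ 1])
        (auto simp: near_star_nonneg near_star_le_1 f)
    fix x
    show "indicator (Pi\<^sub>E {..<4} B) x \<le> ?f x"
    proof (cases "x \<in> Pi\<^sub>E {..<4} B")
      case True
      then have x: "x i \<in> B i" if "i < 4" for i using that by auto
      moreover have "B i \<subseteq> T" if "i < 4" for i using assms(1)[OF that] sets.sets_into_space space_M by blast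
      ultimately have xT: "x i \<in> T" if "i < 4" for i using that by blast
      have "?f x = 1"
        by (rule near_star_eq_1[where v=v]) (use xT x b k e \<open>v \<in> T\<close> in auto)
      then show ?thesis using True by simp
    qed (simp add: near_star_nonneg)
  qed
  finally show ?thesis by (simp add: amt_polynomial_eq)
qed

end

section \<open>Invariance of polynomials under equivalence\<close>

lemma algebraic_measure_trees_iff:
  "(T, c, M) \<in> algebraic_measure_trees \<longleftrightarrow> measure_tree T c M"
  by (auto simp: algebraic_measure_trees_def measure_tree_def measure_tree_axioms_def
      order_separable_tree_def order_separable_tree_axioms_def)

lemma (in prob_space) distr_restrict_space_inclusion:
  assumes A: "A \<in> events" "prob A = 1"
  shows "(\<lambda>x. x) \<in> restrict_space M A \<rightarrow>\<^sub>M M" "distr (restrict_space M A) M (\<lambda>x. x) = M"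
    "prob_space (restrict_space M A)"
proof -
  show incl: "(\<lambda>x. x) \<in> restrict_space M A \<rightarrow>\<^sub>M M" by (rule measurable_restrict_space1) simp
  show "prob_space (restrict_space M A)"
    using A by (intro prob_space_restrict_space) (simp_all add: emeasure_eq_measure)
  show "distr (restrict_space M A) M (\<lambda>x. x) = M"
  proof (rule measure_eqI)
    fix B assume "B \<in> sets (distr (restrict_space M A) M (\<lambda>x. x))"
    then have B: "B \<in> sets M" by simp
    have "emeasure (distr (restrict_space M A) M (\<lambda>x. x)) B = emeasure (restrict_space M A) (B \<inter> A)"
      using B A by (subst emeasure_distr[OF incl])
        (auto simp: space_restrict_space Int_ac dest: sets.sets_into_space intro!: arg_cong2[where f=emeasure])
    also have "\<dots> = emeasure M (B \<inter> A)"
      using A B by (intro emeasure_restrict_space) (auto simp: sets.Int_space_eq2)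
    also have "\<dots> = emeasure M B"
    proof (rule emeasure_eq_AE)
      have "AE x in M. x \<in> A" using A prob_eq_1 by blast
      then show "AE x in M. x \<in> B \<inter> A \<longleftrightarrow> x \<in> B" by eventually_elim simp
    qed (use A B in auto)
    finally show "emeasure (distr (restrict_space M A) M (\<lambda>x. x)) B = emeasure M B" .
  qed simp
qed

text \<open>\<open>g\<close> embeds a set of full measure; this allows to compare two equivalent trees on a common
  probability space \<open>N\<close>.\<close>

lemma (in measure_tree) amt_polynomial_distr:
  assumes N: "prob_space N" and g [measurable]: "g \<in> N \<rightarrow>\<^sub>M M" and M: "distr N M g = M"
    and \<phi>: "\<phi> \<in> bounded_continuous m"
  shows "amt_polynomial m \<phi> (T, c, M) =
    (\<integral>x. \<phi> (distance_matrix m (T, c, M) (\<lambda>i. g (x i))) \<partial>(\<Pi>\<^sub>M i\<in>{..<m}. N))"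
proof -
  let ?P = "\<Pi>\<^sub>M i\<in>{..<m}. M"
  have "?P = (\<Pi>\<^sub>M i\<in>{..<m}. distr N M g)" by (simp add: M)
  also have "\<dots> = distr (\<Pi>\<^sub>M i\<in>{..<m}. N) ?P (compose {..<m} g)"
    using N prob_space_axioms by (intro distr_PiM_finite_prob_space'[symmetric]) auto
  finally have P: "?P = distr (\<Pi>\<^sub>M i\<in>{..<m}. N) ?P (compose {..<m} g)" .
  have comp: "compose {..<m} g \<in> (\<Pi>\<^sub>M i\<in>{..<m}. N) \<rightarrow>\<^sub>M ?P"
    unfolding compose_def by measurable
  have "amt_polynomial m \<phi> (T, c, M) =
      (\<integral>x. \<phi> (distance_matrix m (T, c, M) x) \<partial>distr (\<Pi>\<^sub>M i\<in>{..<m}. N) ?P (compose {..<m} g))"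
    unfolding amt_polynomial_eq by (subst P) (rule refl)
  also have "\<dots> = (\<integral>x. \<phi> (distance_matrix m (T, c, M) (compose {..<m} g x)) \<partial>(\<Pi>\<^sub>M i\<in>{..<m}. N))"
    by (rule integral_distr[OF comp measurable_distance_matrix[OF \<phi>]])
      (auto intro: measurable_component_singleton)
  also have "\<dots> = (\<integral>x. \<phi> (distance_matrix m (T, c, M) (\<lambda>i. g (x i))) \<partial>(\<Pi>\<^sub>M i\<in>{..<m}. N))"
    by (intro Bochner_Integration.integral_cong arg_cong[where f=\<phi>])
      (auto simp: distance_matrix_def compose_def fun_eq_iff)
  finally show ?thesis .
qed

text \<open>The threefold product of M is the image of that of N, so branch points can be sampled
  through g.\<close>

lemma (in measure_tree) measure_\<nu>_distr:
  assumes N: "prob_space N" and g [measurable]: "g \<in> N \<rightarrow>\<^sub>M M" and M: "distr N M g = M"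
    and B [measurable]: "B \<in> sets M"
  shows "measure \<nu> B =
    measure (N \<Otimes>\<^sub>M (N \<Otimes>\<^sub>M N)) {(x, y, z)\<in>space N \<times> space N \<times> space N. c (g x) (g y) (g z) \<in> B}"
proof -
  interpret N: prob_space N by fact
  have "M \<Otimes>\<^sub>M M = distr (N \<Otimes>\<^sub>M N) (M \<Otimes>\<^sub>M M) (\<lambda>(x, y). (g x, g y))"
    using pair_measure_distr[OF g g] sigma_finite_measure_axioms by (simp add: M)
  moreover have MM: "prob_space (M \<Otimes>\<^sub>M M)" by (intro prob_space_pair prob_space_axioms)
  ultimately have M3: "M3 = distr (N \<Otimes>\<^sub>M (N \<Otimes>\<^sub>M N)) M3 (\<lambda>(x, y). (g x, (\<lambda>(x, y). (g x, g y)) y))"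
    using pair_measure_distr[OF g, of "\<lambda>(x, y). (g x, g y)" "N \<Otimes>\<^sub>M N" "M \<Otimes>\<^sub>M M"]
      prob_space_imp_sigma_finite[OF MM] by (simp add: M)
  have "measure \<nu> B = measure (distr (N \<Otimes>\<^sub>M (N \<Otimes>\<^sub>M N)) M3 (\<lambda>(x, y). (g x, (\<lambda>(x, y). (g x, g y)) y)))
      {p\<in>space M3. (\<lambda>(x, y, z). c x y z) p \<in> B}"
    unfolding measure_\<nu>[OF B] M3[symmetric] ..
  also have "\<dots> = measure (N \<Otimes>\<^sub>M (N \<Otimes>\<^sub>M N))
      {(x, y, z)\<in>space N \<times> space N \<times> space N. c (g x) (g y) (g z) \<in> B}"
  proof (subst measure_distr)
    show "{p\<in>space M3. (\<lambda>(x, y, z). c x y z) p \<in> B} \<in> sets M3" by measurable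
  qed (use measurable_space[OF g] in \<open>auto simp: space_pair_measure intro!: arg_cong2[where f=measure]\<close>)
  finally show ?thesis .
qed

lemma amt_polynomial_invariant:
  assumes rel: "(t1, t2) \<in> amt_rel" and \<phi>: "\<phi> \<in> bounded_continuous m"
  shows "amt_polynomial m \<phi> t1 = amt_polynomial m \<phi> t2"
proof -
  obtain T1 c1 M1 T2 c2 M2 where t: "t1 = (T1, c1, M1)" "t2 = (T2, c2, M2)" by (metis prod.exhaust)
  interpret t1: measure_tree T1 c1 M1
    using rel by (simp add: t amt_rel_def algebraic_measure_trees_iff)
  interpret t2: measure_tree T2 c2 M2
    using rel by (simp add: t amt_rel_def algebraic_measure_trees_iff)
  obtain A1 A2 f where sub: "subtree A1 T1 c1" "subtree A2 T2 c2"
    and A1: "A1 \<in> sets M1" "measure M1 A1 = 1" and A2: "A2 \<in> sets M2" "measure M2 A2 = 1"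
    and iso: "tree_iso A1 c1 A2 c2 f"
    and f: "f \<in> restrict_space M1 A1 \<rightarrow>\<^sub>M restrict_space M2 A2"
    and f_distr: "distr (restrict_space M1 A1) (restrict_space M2 A2) f = restrict_space M2 A2"
    using rel unfolding t amt_rel_def amt_equivalent_def by auto
  define N where "N = restrict_space M1 A1"
  note incl1 = t1.distr_restrict_space_inclusion[OF A1, folded N_def]
  note incl2 = t2.distr_restrict_space_inclusion[OF A2]
  have f2: "f \<in> N \<rightarrow>\<^sub>M M2"
    using measurable_compose[OF f incl2(1)] by (simp add: N_def)
  have f2_distr: "distr N M2 f = M2"
    using distr_distr[OF incl2(1) f] f_distr incl2(2) by (simp add: N_def comp_def)
  have spN: "space N = A1"
    using A1(1) sets.sets_into_space by (auto simp: N_def space_restrict_space)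
  have A1T: "A1 \<subseteq> T1" and A2T: "A2 \<subseteq> T2" using sub by (auto simp: subtree_def)
  have fA: "f x \<in> A2" if "x \<in> A1" for x
    using that iso by (auto simp: tree_iso_def bij_betw_def)
  have f_inj: "f x = f y \<longleftrightarrow> x = y" if "x \<in> A1" "y \<in> A1" for x y
    using that iso by (auto simp: tree_iso_def bij_betw_def inj_on_def)
  have f_hom: "f (c1 x y z) = c2 (f x) (f y) (f z)" if "x \<in> A1" "y \<in> A1" "z \<in> A1" for x y z
    using that iso by (auto simp: tree_iso_def)
  have c1A: "c1 x y z \<in> A1" if "x \<in> A1" "y \<in> A1" "z \<in> A1" for x y z
    using that sub by (auto simp: subtree_def)
  \<comment> \<open>Samples from A1 have their branch points in A1, and f respects these, so it is
    enough that B and B' correspond on A1. This matters for intervals, which may leave A1 and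
    A2.\<close>
  have \<nu>_eq: "measure t1.\<nu> B = measure t2.\<nu> B'"
    if B: "B \<in> sets M1" "B' \<in> sets M2" "\<And>x. x \<in> A1 \<Longrightarrow> x \<in> B \<longleftrightarrow> f x \<in> B'" for B B'
  proof -
    have "{(x, y, z)\<in>space N \<times> space N \<times> space N. c1 x y z \<in> B} =
        {(x, y, z)\<in>space N \<times> space N \<times> space N. c2 (f x) (f y) (f z) \<in> B'}"
      using B(3) c1A f_hom by (auto simp: spN)
    then show ?thesis
      using t1.measure_\<nu>_distr[OF incl1(3,1,2) B(1)] t2.measure_\<nu>_distr[OF incl1(3) f2 f2_distr B(2)]
      by simp
  qed
  have d: "t1.d x y = t2.d (f x) (f y)" if x: "x \<in> A1" "y \<in> A1" for x y
  proof -
    have T: "x \<in> T1" "y \<in> T1" "f x \<in> T2" "f y \<in> T2" using x A1T A2T fA by auto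
    have "measure t1.\<nu> (tree_interval T1 c1 x y) = measure t2.\<nu> (tree_interval T2 c2 (f x) (f y))"
    proof (rule \<nu>_eq)
      fix z assume "z \<in> A1"
      then show "z \<in> tree_interval T1 c1 x y \<longleftrightarrow> f z \<in> tree_interval T2 c2 (f x) (f y)"
        using x A1T A2T fA f_inj[of "c1 x y z" z] c1A
        by (auto simp: tree_interval_def f_hom[symmetric])
    qed (use T in simp_all)
    moreover have "measure t1.\<nu> {u} = measure t2.\<nu> {f u}" if "u \<in> A1" for u
    proof (rule \<nu>_eq)
      show "{u} \<in> sets M1" using that A1T by (intro t1.singleton_sets) auto
      show "{f u} \<in> sets M2" using fA[OF that] A2T by (intro t2.singleton_sets) auto
    qed (simp add: that f_inj)
    ultimately show ?thesis using x by (simp add: t1.d_eq t2.d_eq)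
  qed
  have "amt_polynomial m \<phi> t1 =
      (\<integral>x. \<phi> (distance_matrix m t1 x) \<partial>(\<Pi>\<^sub>M i\<in>{..<m}. N))"
    using t1.amt_polynomial_distr[OF incl1(3,1,2) \<phi>] by (simp add: t)
  also have "\<dots> = (\<integral>x. \<phi> (distance_matrix m t2 (\<lambda>i. f (x i))) \<partial>(\<Pi>\<^sub>M i\<in>{..<m}. N))"
  proof (intro Bochner_Integration.integral_cong arg_cong[where f=\<phi>] refl)
    fix x assume "x \<in> space (\<Pi>\<^sub>M i\<in>{..<m}. N)"
    then have "x i \<in> A1" if "i < m" for i
      using that by (auto simp: space_PiM spN)
    then show "distance_matrix m t1 x = distance_matrix m t2 (\<lambda>i. f (x i))"
      using d by (auto simp: distance_matrix_def t fun_eq_iff)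
  qed
  also have "\<dots> = amt_polynomial m \<phi> t2"
    using t2.amt_polynomial_distr[OF incl1(3) f2 f2_distr \<phi>] by (simp add: t)
  finally show ?thesis .
qed

section \<open>Closedness\<close>

context measure_tree
begin

text \<open>Convexity leaves intervals unchanged, which transfers order separability, and it
  identifies the trace of the Borel sets of T with those of A. The identity on A is then the
  isomorphism.\<close>

lemma convex_restriction:
  assumes A: "A \<in> sets M" "measure M A = 1"
    and convex: "\<And>x y m. x \<in> A \<Longrightarrow> y \<in> A \<Longrightarrow> m \<in> T \<Longrightarrow> between x m y \<Longrightarrow> m \<in> A"
  shows "measure_tree A c (restrict_space M A)"
    and "((T, c, M), (A, c, restrict_space M A)) \<in> amt_rel"
proof -
  have AT: "A \<subseteq> T" using sets.sets_into_space[OF A(1)] space_M by simp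
  have T [simp]: "x \<in> T" if "x \<in> A" for x using that AT by blast
  have clA: "c x y z \<in> A" if "x \<in> A" "y \<in> A" "z \<in> A" for x y z
    using convex[of x y "c x y z"] that median_between(1)[of x y z] by (simp add: closed)
  interpret A: algebraic_tree A c
  proof
    show "A \<noteq> {}" using A(2) by auto
  qed (simp_all add: clA sym12 sym23 two_point three_point four_point del: insert_iff)
  have interval: "tree_interval A c x y = tree_interval T c x y" if "x \<in> A" "y \<in> A" for x y
  proof -
    have "z \<in> A" if "z \<in> T" "between x z y" for z
      using convex[of x y z] \<open>x \<in> A\<close> \<open>y \<in> A\<close> that by blast
    then show ?thesis
      using AT unfolding tree_interval_def between_def by blast
  qed
  have "order_separable A c"
  proof -
    obtain D where D: "D \<subseteq> T" "countable D"
      and dense: "\<And>x y. x \<in> T \<Longrightarrow> y \<in> T \<Longrightarrow> x \<noteq> y \<Longrightarrow> D \<inter> (tree_interval T c x y - {y}) \<noteq> {}"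
      using order_separable unfolding order_separable_def by metis
    have "D \<inter> A \<inter> (tree_interval A c x y - {y}) \<noteq> {}" if "x \<in> A" "y \<in> A" "x \<noteq> y" for x y
    proof -
      have "tree_interval T c x y \<subseteq> A"
        unfolding interval[OF that(1,2), symmetric] by (auto simp: tree_interval_def)
      then show ?thesis using dense[of x y] that interval[OF that(1,2)] by auto
    qed
    then show ?thesis
      unfolding order_separable_def using D(2) by (intro exI[of _ "D \<inter> A"]) auto
  qed
  then interpret A: order_separable_tree A c by unfold_locales
  have comp: "tree_component A c v w = A \<inter> tree_component T c v w" for v w
    using AT by (auto simp: tree_component_def)
  have spA: "space (restrict_space M A) = A"
    using AT space_M by (auto simp: space_restrict_space)
  have "sets (restrict_space M A) = (\<inter>) A ` sigma_sets T (tree_components T c)"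
    by (simp add: sets_restrict_space sets_M sets_tree_borel)
  also have "\<dots> = sigma_sets A ((\<inter>) A ` tree_components T c)"
    using A(1) AT by (intro sigma_sets_Int) (simp_all add: sets_M sets_tree_borel)
  also have "\<dots> = sigma_sets A (tree_components A c)"
  proof (rule sigma_sets_eqI)
    fix S assume "S \<in> (\<inter>) A ` tree_components T c"
    then obtain v w where v: "v \<in> T" "w \<in> T" "v \<noteq> w" and S: "S = A \<inter> tree_component T c v w"
      by (auto simp: tree_components_def)
    \<comment> \<open>In the third case the cut point v equals y or separates two points of A, so it
      lies in A by convexity; the direction w, possibly outside A, is replaced by x.\<close>
    consider "S = {}" | "S = A" | x y where "x \<in> S" "y \<in> A" "y \<notin> S" using S by blast
    then show "S \<in> sigma_sets A (tree_components A c)"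
    proof cases
      case 3
      then have xy [simp]: "x \<in> A" "y \<in> A" and x: "x \<in> tree_component T c v w"
        and y: "y \<notin> tree_component T c v w" using S by auto
      have eq: "tree_component T c v x = tree_component T c v w"
        using component_cong v x by blast
      have "between x v y" if "y \<noteq> v"
        using y that v unfolding eq[symmetric] by (simp add: mem_component)
      then have "v \<in> A"
        using convex[OF xy v(1)] xy(2) by blast
      moreover have "x \<noteq> v" using x v by (auto simp: mem_component)
      ultimately have "S \<in> tree_components A c"
        unfolding S eq[symmetric] tree_components_def comp[symmetric] by force
      then show ?thesis by (rule sigma_sets.Basic)
    qed (auto intro: sigma_sets.Empty sigma_sets_top)
  next
    fix S assume "S \<in> tree_components A c"
    then have "S \<in> (\<inter>) A ` tree_components T c"
      using AT unfolding tree_components_def comp by blast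
    then show "S \<in> sigma_sets A ((\<inter>) A ` tree_components T c)" by (rule sigma_sets.Basic)
  qed
  also have "\<dots> = sets (tree_borel A c)" by (rule A.sets_tree_borel[symmetric])
  finally have sets: "sets (restrict_space M A) = sets (tree_borel A c)" .
  note prob = distr_restrict_space_inclusion(3)[OF A]
  show tree: "measure_tree A c (restrict_space M A)"
    using A.order_separable_tree_axioms prob spA sets
    by (simp add: measure_tree_def measure_tree_axioms_def)
  have rr: "restrict_space (restrict_space M A) A = restrict_space M A"
    using A(1) by (simp add: restrict_restrict_space sets.Int_space_eq2)
  have "measure (restrict_space M A) A = 1"
    using prob_space.prob_space[OF prob] by (simp add: spA)
  moreover have "A \<in> sets (restrict_space M A)"
    using sets.top[of "restrict_space M A"] by (simp add: spA)
  moreover have "subtree A T c" "subtree A A c"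
    using A.nonempty AT clA by (auto simp: subtree_def)
  moreover have "tree_iso A c A c (\<lambda>x. x)" by (simp add: tree_iso_def bij_betw_def)
  moreover have "distr (restrict_space M A) (restrict_space M A) (\<lambda>x. x) = restrict_space M A"
    by (rule distr_id2) simp
  ultimately have "amt_equivalent (T, c, M) (A, c, restrict_space M A)"
    unfolding amt_equivalent_def prod.case using A
    by (intro exI[of _ A] exI[of _ "\<lambda>x. x"]) (simp add: rr)
  then show "((T, c, M), (A, c, restrict_space M A)) \<in> amt_rel"
    using tree measure_tree_axioms by (simp add: amt_rel_def algebraic_measure_trees_iff)
qed

text \<open>A representative of a class in the closure may still have superfluous components of mass
  zero; they are ignored here and removed in \<open>essentially_binary_representative\<close>.\<close>

definition essentially_binary :: bool where
  "essentially_binary \<longleftrightarrow>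
    (\<forall>v\<in>T. \<forall>X. star v X \<longrightarrow> (\<forall>x\<in>X. measure M (tree_component T c v x) > 0) \<longrightarrow>
      card X \<le> 3 \<and> (measure M {v} > 0 \<longrightarrow> card X \<le> 1))"

lemma star_between:
  assumes X: "star v X" and v: "v \<in> T" and x: "x \<in> X" "y \<in> X" "x \<noteq> y"
    and x': "x' \<in> tree_component T c v x" "y' \<in> tree_component T c v y"
  shows "between x' v y'"
proof -
  have [simp]: "x \<in> T" "y \<in> T" "x' \<in> T" "y' \<in> T"
    using X x x' component_subset by (auto simp: star_def)
  have "between x v y" using X x by (auto simp: star_def pairwise_def)
  then have "between y v x'"
    using between_component[of v x y x'] x'(1) v between_commute[of x' v y] by simp
  then show ?thesis
    using between_component[of v y x' y'] x'(2) v between_commute[of y' v x'] by simp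
qed

text \<open>A failure at v supplies four sets of positive mass around v to which
  \<open>amt_polynomial_near_star_ge\<close> applies; \<delta> is the product of their
  masses.\<close>

lemma amt_polynomial_lower_bound:
  assumes "\<not> essentially_binary"
  shows "\<exists>k \<delta>. 0 < k \<and> k \<le> 1 \<and> 0 < \<delta> \<and>
    (\<forall>e>0. \<delta> \<le> amt_polynomial 4 (near_star k e) (T, c, M))"
proof -
  obtain v X where v [simp]: "v \<in> T" and X: "star v X"
    and pos: "\<And>x. x \<in> X \<Longrightarrow> measure M (tree_component T c v x) > 0"
    and card: "card X > 3 \<or> measure M {v} > 0 \<and> card X > 1"
    using assms unfolding essentially_binary_def by (auto simp: not_le)
  have fin: "finite X" using card card.infinite[of X] by fastforce
  obtain h where h: "bij_betw h {0..<card X} X" using ex_bij_betw_nat_finite[OF fin] by blast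
  have hX: "h i \<in> X" if "i < card X" for i using h that by (auto simp: bij_betw_def)
  have h_inj: "h i \<noteq> h j" if "i < j" "j < card X" for i j
    using inj_onD[of h "{0..<card X}" i j] h that by (auto simp: bij_betw_def)
  have XT: "x \<in> T" "x \<noteq> v" if "x \<in> X" for x using X that by (auto simp: star_def)
  \<comment> \<open>Either there are four components to choose from, or v is an atom with at least
    two components, and \<open>B 2\<close> and \<open>B 3\<close> become degenerate arms
    {v}.\<close>
  define B where "B i = (if 3 < card X \<or> i < 2 then tree_component T c v (h i) else {v})" for i
  have card2: "1 < card X" using card by auto
  have Bi: "(i < card X \<and> B i = tree_component T c v (h i)) \<or>
      (2 \<le> i \<and> card X \<le> 3 \<and> B i = {v} \<and> measure M {v} > 0)" if "i < 4" for i
    using that card card2 by (auto simp: B_def)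
  have B_sets: "B i \<in> sets M" if "i < 4" for i
    using Bi[OF that] hX[of i] XT[of "h i"] by auto
  have B_pos: "0 < measure M (B i)" if "i < 4" for i
    using Bi[OF that] hX[of i] pos[of "h i"] by auto
  have B_T: "x \<in> T" if "i < 4" "x \<in> B i" for i x
    using sets.sets_into_space[OF B_sets[OF that(1)]] that(2) space_M by blast
  have B_between: "between x v y" if "i < j" "j < 4" "x \<in> B i" "y \<in> B j" for i j x y
  proof (cases "B j = {v}")
    case True
    then show ?thesis using that B_T[of i x] by simp
  next
    case False
    then have j: "j < card X" "B j = tree_component T c v (h j)" using Bi[OF that(2)] by auto
    show ?thesis
    proof (cases "B i = {v}")
      case True
      then show ?thesis using that B_T[of j y] by simp
    next
      case False
      then have i: "B i = tree_component T c v (h i)" using Bi[of i] that by auto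
      show ?thesis
        using star_between[OF X v hX hX h_inj[OF that(1) j(1)]] j i that by simp
    qed
  qed
  \<comment> \<open>Every arm at v has length at least \<nu>{v} / 2, which is 2 * k.\<close>
  define k where "k = measure \<nu> {v} / 4"
  have "0 < measure M (B 0) * measure M (B 1) * measure M (B 2)"
    by (intro mult_pos_pos B_pos) simp_all
  also have "\<dots> \<le> measure \<nu> {v}"
  proof (rule \<nu>_lower)
    fix x y z assume "x \<in> B 0" "y \<in> B 1" "z \<in> B 2"
    then show "c x y z \<in> {v}"
      using B_between[of 0 1 x y] B_between[of 0 2 x z] B_between[of 1 2 y z]
        B_T[of 0 x] B_T[of 1 y] B_T[of 2 z] by (simp add: median_eqI)
  qed (simp_all add: B_sets)
  finally have k: "0 < k" by (simp add: k_def)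
  have k1: "k \<le> 1" using order_trans[OF \<nu>.prob_le_1, of 4 "{v}"] by (simp add: k_def)
  have arm: "2 * k \<le> d x v" if "x \<in> T" "x \<noteq> v" for x
    using \<nu>_singleton_le[of x v v] that by (simp add: k_def)
  have arms: "2 * k \<le> d x v" if "x \<in> B 0 \<union> B 1" for x
  proof -
    have "B 0 = tree_component T c v (h 0)" "B 1 = tree_component T c v (h 1)"
      by (simp_all add: B_def)
    then have "x \<noteq> v" using that by (auto simp: tree_component_def)
    then show ?thesis using arm that B_T[of 0 x] B_T[of 1 x] by auto
  qed
  \<comment> \<open>For proper arms the left side is at most k, as distances are at most 1; for
    degenerate arms both sides are 0.\<close>
  have arms': "k * d y v \<le> d x v" if "x \<in> B 2" "y \<in> B 3" for x y
  proof (cases "3 < card X")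
    case True
    then have "x \<noteq> v" using that by (auto simp: B_def tree_component_def)
    then have "2 * k \<le> d x v" using arm B_T[of 2 x] that by simp
    moreover have "k * d y v \<le> k" using mult_left_mono[OF d_le_1[of y v], of k] k by simp
    ultimately show ?thesis using k by linarith
  next
    case False
    then show ?thesis using that d_same[of v] by (simp add: B_def)
  qed
  have "(\<Prod>i<4. measure M (B i)) \<le> amt_polynomial 4 (near_star k e) (T, c, M)" if "0 < e" for e
    by (rule amt_polynomial_near_star_ge[OF B_sets v B_between k arms arms' that])
  moreover have "0 < (\<Prod>i<4. measure M (B i))"
    by (intro prod_pos) (simp add: B_pos)
  ultimately show ?thesis using k k1 by blast
qed

text \<open>Deleting all components of mass zero leaves a convex set A of full mass. A component at
  a point of A that contains another point of A has positive mass, so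
  \<open>essentially_binary\<close> controls all stars in A.\<close>

lemma essentially_binary_representative:
  assumes "essentially_binary"
  shows "\<exists>A N. ((T, c, M), (A, c, N)) \<in> amt_rel \<and> binary_tree A c \<and>
    {x \<in> A. measure N {x} > 0} \<subseteq> leaves A c"
proof -
  obtain \<B> where \<B>: "countable \<B>" "\<B> \<subseteq> tree_components T c"
    "\<And>S z. S \<in> tree_components T c \<Longrightarrow> z \<in> S \<Longrightarrow> \<exists>U\<in>\<B>. z \<in> U \<and> U \<subseteq> S"
    using countable_component_base by metis
  have comp_sets: "S \<in> sets M" if "S \<in> tree_components T c" for S
    using that by (auto simp: tree_components_def)
  define \<N> where "\<N> = {S \<in> tree_components T c. measure M S = 0}"
  \<comment> \<open>There may be uncountably many null components, but every point of their union
    lies in a null member of the countable base.\<close>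
  have "\<Union>\<N> = \<Union>(\<B> \<inter> \<N>)"
  proof
    show "\<Union>\<N> \<subseteq> \<Union>(\<B> \<inter> \<N>)"
    proof
      fix z assume "z \<in> \<Union>\<N>"
      then obtain S where S: "S \<in> tree_components T c" "measure M S = 0" "z \<in> S"
        by (auto simp: \<N>_def)
      then obtain U where U: "U \<in> \<B>" "z \<in> U" "U \<subseteq> S" using \<B>(3) by blast
      have "measure M U \<le> measure M S" by (rule finite_measure_mono[OF U(3) comp_sets[OF S(1)]])
      then have "U \<in> \<N>" using S U \<B>(2) measure_nonneg[of M U] by (auto simp: \<N>_def)
      then show "z \<in> \<Union>(\<B> \<inter> \<N>)" using U by blast
    qed
  qed auto
  moreover have "(\<Union>S\<in>\<B> \<inter> \<N>. S) \<in> null_sets M"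
    using \<B>(1) comp_sets by (intro null_sets_UN')
      (auto simp: \<N>_def emeasure_eq_measure intro: countable_Int1)
  ultimately have null: "\<Union>\<N> \<in> null_sets M" by simp
  define A where "A = T - \<Union>\<N>"
  have A: "A \<in> sets M" using null sets.top[of M] unfolding A_def space_M by auto
  have "measure M A = 1"
    using null prob_compl[of "\<Union>\<N>"] by (simp add: A_def space_M measure_eq_0_null_sets null_setsD2)
  have convex: "m \<in> A" if "x \<in> A" "y \<in> A" "m \<in> T" "between x m y" for x y m
  proof -
    have "m \<notin> S" if "S \<in> \<N>" for S
    proof -
      obtain a b where "a \<in> T" "b \<in> T" "S = tree_component T c a b"
        using \<open>S \<in> \<N>\<close> by (auto simp: \<N>_def tree_components_def)
      moreover have "x \<in> T - S" "y \<in> T - S"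
        using \<open>x \<in> A\<close> \<open>y \<in> A\<close> that by (auto simp: A_def)
      ultimately show ?thesis
        using co_component_convex[of a b x y m] \<open>m \<in> T\<close> \<open>between x m y\<close> by simp
    qed
    then show ?thesis using \<open>m \<in> T\<close> by (auto simp: A_def)
  qed
  let ?N = "restrict_space M A"
  have restr: "measure_tree A c ?N" "((T, c, M), (A, c, ?N)) \<in> amt_rel"
    using convex_restriction[OF A \<open>measure M A = 1\<close>] convex by blast+
  interpret A: measure_tree A c ?N by (rule restr(1))
  have AT: "x \<in> T" if "x \<in> A" for x using that by (simp add: A_def)
  have pos: "measure M (tree_component T c v w) > 0" if "v \<in> A" "w \<in> A" "w \<noteq> v" for v w
  proof -
    have "w \<in> tree_component T c v w" using that AT by (intro component_self) auto
    then have "tree_component T c v w \<notin> \<N>" using that by (auto simp: A_def)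
    moreover have "tree_component T c v w \<in> tree_components T c"
      using that AT by (auto simp: tree_components_def)
    ultimately show ?thesis
      using measure_nonneg[of M "tree_component T c v w"] by (auto simp: \<N>_def less_le)
  qed
  have star: "card X \<le> 3 \<and> (measure M {v} > 0 \<longrightarrow> card X \<le> 1)" if "v \<in> A" "A.star v X" for v X
  proof -
    have "star v X"
      using that AT by (auto simp: A.star_def star_def A.between_def between_def pairwise_def)
    moreover have "\<forall>x\<in>X. measure M (tree_component T c v x) > 0"
      using that pos by (auto simp: A.star_def)
    ultimately show ?thesis
      using assms AT[OF that(1)] unfolding essentially_binary_def by blast
  qed
  have "binary_tree A c" unfolding A.binary_tree_iff using star by blast
  moreover have "{x \<in> A. measure ?N {x} > 0} \<subseteq> leaves A c"
  proof
    fix v assume "v \<in> {x \<in> A. measure ?N {x} > 0}"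
    then have v: "v \<in> A" "measure M {v} > 0"
      using A by (auto simp: measure_restrict_space sets.Int_space_eq2)
    have "c v x y \<noteq> v" if xy: "x \<in> A - {v}" "y \<in> A - {v}" for x y
    proof
      assume "c v x y = v"
      then have b: "A.between x v y" using xy v A.c_rotate[of v x y] by (simp add: A.between_def)
      then have "x \<noteq> y" using A.between_same[of x v] xy v by auto
      then have "A.star v {x, y}"
        using xy v b A.between_commute[of x v y] by (auto simp: A.star_def pairwise_def)
      then show False using star[of v "{x, y}"] v \<open>x \<noteq> y\<close> by simp
    qed
    then show "v \<in> leaves A c" using v by (simp add: leaves_def)
  qed
  ultimately show ?thesis using restr(2) by blast
qed

end

section \<open>Equivalence classes and the separating open set\<close>

lemma amt_space_polynomial:
  assumes X: "X \<in> amt_space" and t: "t \<in> X" and \<phi>: "\<phi> \<in> bounded_continuous m"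
  shows "the_elem (amt_polynomial m \<phi> ` X) = amt_polynomial m \<phi> t"
proof -
  obtain t0 where "X = amt_rel `` {t0}" using X by (auto simp: amt_space_def quotient_def)
  then have "amt_polynomial m \<phi> s = amt_polynomial m \<phi> t" if "s \<in> X" for s
    using amt_polynomial_invariant[OF _ \<phi>, of t0] that t by (metis ImageE singletonD)
  then have "amt_polynomial m \<phi> ` X = (\<lambda>_. amt_polynomial m \<phi> t) ` X" by (intro image_cong) simp_all
  then show ?thesis using t by (simp add: image_constant[OF t])
qed

theorem corollary5p19:
  shows "closedin (bpdd_Gromov_weak :: 'a tree_triple set topology) amt_space2"
proof -
  have "\<exists>U. openin bpdd_Gromov_weak U \<and> X \<in> U \<and> U \<subseteq> amt_space - amt_space2"
    if X: "X \<in> amt_space - amt_space2" for X :: "'a tree_triple set"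
  proof -
    obtain T c M where t: "(T, c, M) \<in> algebraic_measure_trees" and XT: "X = amt_rel `` {(T, c, M)}"
      using X by (auto simp: amt_space_def quotient_def)
    interpret measure_tree T c M using t by (simp add: algebraic_measure_trees_iff)
    have "\<not> essentially_binary"
    proof
      assume essentially_binary
      then obtain A N where "(A, c, N) \<in> X" "binary_tree A c"
        "{x \<in> A. measure N {x} > 0} \<subseteq> leaves A c"
        using essentially_binary_representative XT by auto
      then have "X \<in> amt_space2" using X by (auto simp: amt_space2_def)
      then show False using X by simp
    qed
    then obtain k \<delta> where k: "0 < k" "k \<le> 1" and \<delta>: "0 < \<delta>"
      and lower: "\<And>e. 0 < e \<Longrightarrow> \<delta> \<le> amt_polynomial 4 (near_star k e) (T, c, M)"
      using amt_polynomial_lower_bound by blast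
    \<comment> \<open>This makes the bound 90 * e / k^3 for binary trees equal to \<delta> / 2, half
      the lower bound at X.\<close>
    define e where "e = \<delta> * k ^ 3 / 180"
    have e: "0 < e" using k \<delta> by (simp add: e_def)
    have \<phi>: "near_star k e \<in> bounded_continuous 4" by (rule near_star_bounded_continuous[OF k(1) e])
    define U where "U = {X :: 'a tree_triple set. X \<in> amt_space \<and>
      the_elem (amt_polynomial 4 (near_star k e) ` X) \<in> {\<delta> / 2<..}}"
    have "openin bpdd_Gromov_weak U"
      unfolding bpdd_Gromov_weak_def U_def by (intro topology_generated_by_Basis CollectI exI[of _ 4]
          exI[of _ "near_star k e"] exI[of _ "{\<delta> / 2<..}"] conjI refl \<phi> open_greaterThan)
    moreover have "X \<in> U"
    proof -
      have [simp]: "T \<in> sets M" using sets.top[of M] space_M by simp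
      \<comment> \<open>The triple with M restricted to its whole space is a member of X, and
        invariance carries its polynomial value back to M.\<close>
      have rel: "((T, c, M), (T, c, restrict_space M T)) \<in> amt_rel"
        using prob_space space_M by (intro convex_restriction(2)) auto
      then have "(T, c, restrict_space M T) \<in> X" by (simp add: XT)
      then have "the_elem (amt_polynomial 4 (near_star k e) ` X) =
          amt_polynomial 4 (near_star k e) (T, c, M)"
        using amt_space_polynomial[OF _ _ \<phi>, of X "(T, c, restrict_space M T)"]
          amt_polynomial_invariant[OF rel \<phi>] X by simp
      then show ?thesis using lower[OF e] \<delta> X by (simp add: U_def)
    qed
    moreover have "Y \<notin> amt_space2" if Y: "Y \<in> U" for Y
    proof
      assume "Y \<in> amt_space2"
      then obtain S c' N where s: "(S, c', N) \<in> Y" "binary_tree S c'"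
        "{x \<in> S. measure N {x} > 0} \<subseteq> leaves S c'"
        by (auto simp: amt_space2_def)
      have "(S, c', N) \<in> algebraic_measure_trees"
        using s(1) Y by (auto simp: U_def amt_space_def quotient_def amt_rel_def)
      then interpret S: binary_measure_tree S c' N
        using s(2,3) by (simp add: binary_measure_tree_def binary_measure_tree_axioms_def
            algebraic_measure_trees_iff)
      have "the_elem (amt_polynomial 4 (near_star k e) ` Y) \<le> 90 * e / k ^ 3"
        using S.amt_polynomial_near_star_le[OF k e] amt_space_polynomial[OF _ s(1) \<phi>] Y
        by (simp add: U_def)
      also have "\<dots> = \<delta> / 2" using k by (simp add: e_def)
      finally show False using Y by (simp add: U_def)
    qed
    ultimately show ?thesis unfolding U_def by blast
  qed
  then have "openin bpdd_Gromov_weak (amt_space - amt_space2 :: 'a tree_triple set set)"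
    by (subst openin_subopen) blast
  then show ?thesis
    by (auto simp: closedin_def topspace_bpdd_Gromov_weak amt_space2_def)
qed

end
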